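(* Let $C$ be the contour in the complex plane described in the context. For any $\tau\in\mathbb{C}$ with $-\tau\notin\mathbb{N}$, the Euler Gamma function satisfies the following integral representation: $$\Gamma(\tau+1)=\frac{2}{\sqrt{\pi}\,(e^{2\pi i\tau}-1)}\int_{C}\zeta^{\tau}H_\tau(\zeta)\,e^{-\zeta^2}\,d\zeta,$$ where $H_\tau$ is the Hermite function of degree $\tau$.
   Context: Here $\mathbb{N}=\{1,2,3,\dots\}$, so the condition $-\tau\notin\mathbb{N}$ says that $\tau$ is not a negative integer. The Hermite function of degree $\tau\in\mathbb{C}$ is the entire function $$H_\tau(x)=2^\tau\frac{\Gamma(\frac12)}{\Gamma(\frac{1-\tau}{2})}\,{}_1F_1\left(-\frac{\tau}{2};\frac12;x^2\right)+2^{\tau}x\,\frac{\Gamma(-\frac12)}{\Gamma(-\frac{\tau}{2})}\,{}_1F_1\left(\frac{1-\tau}{2};\frac32;x^2\right),$$ where ${}_1F_1(a;b;z)=\sum_{k\ge0}\frac{(a)_k}{(b)_k}\frac{z^k}{k!}$, $(a)_0=1$, $(a)_k=a(a+1)\cdots(a+k-1)$ for $k\ge 1$, and $1/\Gamma$ is taken to be $0$ at the poles of $\Gamma$. The contour $C$ starts at $+\infty$ just above the positive real axis (asymptotic to it), comes in toward the origin, encircles the origin once counterclockwise (crossing the negative real axis from the upper to the lower half-plane), and returns to $+\infty$ just below the positive real axis (asymptotic to it), without meeting $[0,\infty)$. On $C$, $\zeta^{\tau}=e^{\tau(\ln|\zeta|+i\arg\zeta)}$ with $0<\arg\zeta<2\pi$,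 so that $\arg\zeta\to0$ at the starting end and $\arg\zeta\to2\pi$ at the final end.
   Formalization: At τ = 0, 1, 2, … the factor e^{2πiτ} − 1 and the integral both vanish, so the printed right-hand side is 0/0; there the formula is proved as a limit of the right-hand side as σ → τ, σ ≠ τ. For all other admitted τ it is a literal equality. *)

theory Defs
  imports "HOL-Complex_Analysis.Complex_Analysis"
begin

definition hyp_1F1 :: "complex \<Rightarrow> complex \<Rightarrow> complex \<Rightarrow> complex" where
  "hyp_1F1 a b z = (\<Sum>k. pochhammer a k / pochhammer b k * (z ^ k / fact k))"

text \<open>\<^const>\<open>rGamma\<close> is the reciprocal Gamma function, equal to 0 at the poles of \<^const>\<open>Gamma\<close>.\<close>

definition hermite_fun :: "complex \<Rightarrow> complex \<Rightarrow> complex" where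
  "hermite_fun \<tau> x =
     2 powr \<tau> * (Gamma (1/2) * rGamma ((1 - \<tau>) / 2)) * hyp_1F1 (- \<tau> / 2) (1/2) (x\<^sup>2) +
     2 powr \<tau> * x * (Gamma (- 1/2) * rGamma (- \<tau> / 2)) * hyp_1F1 ((1 - \<tau>) / 2) (3/2) (x\<^sup>2)"

text \<open>The branch of the power with argument in \<open>(0, 2\<pi>)\<close> off the half-line \<open>[0, \<infinity>)\<close>;
  \<^const>\<open>powr\<close> uses the principal branch instead.\<close>

definition cpow_2pi :: "complex \<Rightarrow> complex \<Rightarrow> complex" where
  "cpow_2pi \<zeta> \<tau> =
     exp (\<tau> * (complex_of_real (ln (cmod \<zeta>)) + \<i> * complex_of_real (Arg2pi \<zeta>)))"

text \<open>Contours with two infinite ends are parametrised over the whole real line. Such a contour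
  avoids \<open>[0, \<infinity>)\<close>, so \<^const>\<open>Arg2pi\<close> is continuous along it and goes from 0 at the
  end above the axis to \<open>2\<pi>\<close> at the end below it. This is what it means to encircle the origin
  once counterclockwise, and it forces the passage from the upper to the lower half-plane through
  the negative real axis.\<close>

definition hankel_contour :: "(real \<Rightarrow> complex) \<Rightarrow> bool" where
  "hankel_contour C \<longleftrightarrow>
     (\<forall>a b. a < b \<longrightarrow> valid_path (subpath a b C)) \<and>
     (\<forall>t. C t \<notin> complex_of_real ` {0..}) \<and>
     filterlim (\<lambda>t. Re (C t)) at_top at_bot \<and>
     ((\<lambda>t. Im (C t)) \<longlongrightarrow> 0) at_bot \<and>
     (\<forall>\<^sub>F t in at_bot. Im (C t) > 0) \<and>
     filterlim (\<lambda>t. Re (C t)) at_top at_top \<and>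
     ((\<lambda>t. Im (C t)) \<longlongrightarrow> 0) at_top \<and>
     (\<forall>\<^sub>F t in at_top. Im (C t) < 0)"

text \<open>Integrals along such contours are improper: the two ends go to infinity independently.\<close>

definition has_improper_contour_integral ::
    "(complex \<Rightarrow> complex) \<Rightarrow> complex \<Rightarrow> (real \<Rightarrow> complex) \<Rightarrow> bool" where
  "has_improper_contour_integral f I C \<longleftrightarrow>
     (\<forall>a b. a < b \<longrightarrow> f contour_integrable_on subpath a b C) \<and>
     ((\<lambda>(a, b). contour_integral (subpath a b C) f) \<longlongrightarrow> I) (at_bot \<times>\<^sub>F at_top)"

definition improper_contour_integrable ::
    "(complex \<Rightarrow> complex) \<Rightarrow> (real \<Rightarrow> complex) \<Rightarrow> bool" where
  "improper_contour_integrable f C \<longleftrightarrow> (\<exists>I. has_improper_contour_integral f I C)"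

definition improper_contour_integral ::
    "(real \<Rightarrow> complex) \<Rightarrow> (complex \<Rightarrow> complex) \<Rightarrow> complex" where
  "improper_contour_integral C f = (THE I. has_improper_contour_integral f I C)"

text \<open>At a nonnegative integer \<open>\<tau>\<close> the factor \<open>exp (2\<pi>\<i>\<tau>) - 1\<close> vanishes, and so does the
  integral. This is a removable singularity in \<open>\<tau>\<close>, where the right-hand side
  denotes its limit; Isabelle's division would give 0 there.\<close>

definition gamma_hermite_rhs :: "(real \<Rightarrow> complex) \<Rightarrow> complex \<Rightarrow> complex" where
  "gamma_hermite_rhs C \<tau> =
     2 / (complex_of_real (sqrt pi) * (exp (2 * complex_of_real pi * \<i> * \<tau>) - 1)) *
     improper_contour_integral C
       (\<lambda>\<zeta>. cpow_2pi \<zeta> \<tau> * hermite_fun \<tau> \<zeta> * exp (- \<zeta>\<^sup>2))"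

end

theory Submission
  imports Defs
begin

text \<open>
  With \<open>G\<^sub>\<tau>(z) = H\<^sub>\<tau>(z) exp (- z\<^sup>2)\<close>, the function \<open>\<zeta>\<^sup>\<tau> G\<^sub>\<tau>(\<zeta>)\<close> has the primitive
  \<open>\<zeta>\<^sup>\<tau>\<^sup>+\<^sup>1 P(\<zeta>)\<close> on the slit plane, where \<open>P\<close> is the entire solution of \<open>z P' + (\<tau> + 1) P = G\<^sub>\<tau>\<close>,
  found by dividing the \<open>k\<close>-th Taylor coefficient of \<open>G\<^sub>\<tau>\<close> by \<open>\<tau> + 1 + k\<close>. So no contour has to be deformed:
  the integral is \<open>(exp (2\<pi>\<i>\<tau>) - 1) L\<close>, with \<open>L\<close> the limit of the primitive at \<open>+\<infinity>\<close>, which exists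
  because \<open>H\<^sub>\<tau>\<close> grows polynomially in the right half-plane.

  Since \<open>G\<^sub>\<tau>' = - G\<^sub>\<tau>\<^sub>+\<^sub>1\<close>, integration by parts shows that both sides satisfy the functional equation of
  \<open>\<Gamma>\<close>, which reduces the claim to \<open>-1 < Re \<tau> < 1\<close>. There \<open>L\<close> is the integral of \<open>x\<^sup>\<tau> G\<^sub>\<tau>(x)\<close> over
  \<open>(0, \<infinity>)\<close>. The recurrence \<open>H\<^sub>\<tau> = 2x H\<^sub>\<tau>\<^sub>-\<^sub>1 - 2(\<tau> - 1) H\<^sub>\<tau>\<^sub>-\<^sub>2\<close> brings in degrees with negative real part,
  for which \<open>H\<^sub>\<sigma>(x)\<close> is \<open>1 / \<Gamma>(-\<sigma>)\<close> times the integral of \<open>t\<^sup>-\<^sup>\<sigma>\<^sup>-\<^sup>1 exp (- t\<^sup>2 - 2tx)\<close> over \<open>t > 0\<close>,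
  and leaves double integrals of \<open>x\<^sup>\<alpha> t\<^sup>\<beta> exp (- (x + t)\<^sup>2)\<close>.
\<close>

subsection \<open>Taylor coefficients of the Hermite functions\<close>

text \<open>Ratio test. Since \<open>Re b > 0\<close>, |b + n| is at least n, and |a + n| is at most
  (|a| + 1) n once n is at least 1. Consecutive terms then have ratio at most (|a| + 1) |z| / (n +
  1), and the cutoff is chosen so that this is below 1/2.\<close>

lemma summable_hyp_1F1:
  fixes a b z :: complex
  assumes b: "Re b > 0"
  shows "summable (\<lambda>k. pochhammer a k / pochhammer b k * (z ^ k / fact k))"
proof (rule summable_ratio_test[where c = "1/2" and N = "nat \<lceil>2 * (cmod a + 1) * cmod z\<rceil> + 1"])
  fix n assume n: "n \<ge> nat \<lceil>2 * (cmod a + 1) * cmod z\<rceil> + 1"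
  have n1: "real n \<ge> 1" "real n \<ge> 2 * (cmod a + 1) * cmod z"
    using n by linarith+
  have "real n \<le> Re (b + of_nat n)" using b by simp
  also have "\<dots> \<le> cmod (b + of_nat n)" by (rule complex_Re_le_cmod)
  finally have bn: "real n \<le> cmod (b + of_nat n)" .
  have an: "cmod (a + of_nat n) \<le> (cmod a + 1) * real n"
  proof -
    have "cmod (a + of_nat n) \<le> cmod a + real n"
      using norm_triangle_ineq[of a "of_nat n"] by simp
    also have "\<dots> \<le> cmod a * real n + real n" using n1(1) mult_left_mono[of 1 "real n" "cmod a"] by simp
    finally show ?thesis by (simp add: algebra_simps)
  qed
  let ?f = "\<lambda>k. pochhammer a k / pochhammer b k * (z ^ k / fact k)"
  have "?f (Suc n) = ?f n * ((a + of_nat n) / (b + of_nat n) * (z / of_nat (Suc n)))"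
    by (simp add: pochhammer_Suc mult_ac)
  hence "norm (?f (Suc n)) = norm (?f n) * (cmod (a + of_nat n) / cmod (b + of_nat n) * (cmod z / real (Suc n)))"
    by (simp add: norm_mult norm_divide del: of_nat_Suc)
  also have "\<dots> \<le> norm (?f n) * (1/2)"
  proof (rule mult_left_mono)
    have "cmod (a + of_nat n) / cmod (b + of_nat n) \<le> (cmod a + 1) * real n / real n"
      using an bn n1 by (intro frac_le) auto
    also have "\<dots> = cmod a + 1" using n1 by simp
    finally have 1: "cmod (a + of_nat n) / cmod (b + of_nat n) \<le> cmod a + 1" .
    have "cmod (a + of_nat n) / cmod (b + of_nat n) * (cmod z / real (Suc n))
        \<le> (cmod a + 1) * (cmod z / real (Suc n))"
      by (rule mult_right_mono[OF 1]) simp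
    also have "\<dots> = ((cmod a + 1) * cmod z) / real (Suc n)" by simp
    also have "\<dots> \<le> 1/2" using n1 by (simp add: field_simps)
    finally show "cmod (a + of_nat n) / cmod (b + of_nat n) * (cmod z / real (Suc n)) \<le> 1/2" .
  qed simp
  finally show "norm (?f (Suc n)) \<le> 1/2 * norm (?f n)" by simp
qed simp

text \<open>The two-step recursion for the Taylor coefficients at 0 is Hermite's equation
  \<open>H'' - 2z H' + 2\<tau> H = 0\<close>.\<close>

fun hermite_coeff :: "complex \<Rightarrow> nat \<Rightarrow> complex" where
  "hermite_coeff \<tau> 0 = 2 powr \<tau> * (Gamma (1/2) * rGamma ((1 - \<tau>) / 2))"
| "hermite_coeff \<tau> (Suc 0) = 2 powr \<tau> * (Gamma (- 1/2) * rGamma (- \<tau> / 2))"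
| "hermite_coeff \<tau> (Suc (Suc k)) =
     2 * (of_nat k - \<tau>) / ((of_nat k + 1) * (of_nat k + 2)) * hermite_coeff \<tau> k"

lemma complex_of_nat_add_nonzero:
  assumes "Re b > 0" shows "of_nat k + b \<noteq> 0" "b + of_nat k \<noteq> 0"
proof -
  have "Re (of_nat k + b) > 0" using assms by simp
  thus "of_nat k + b \<noteq> 0" by force
  thus "b + of_nat k \<noteq> 0" by (simp add: add.commute)
qed

lemma pochhammer_nonzero:
  assumes "Re b > 0" shows "pochhammer b k \<noteq> 0"
  using complex_of_nat_add_nonzero(2)[OF assms]
  by (simp add: pochhammer_eq_0_iff) (metis add.left_inverse)

text \<open>Cancelling 4 from numerator and denominator turns the factor of the two-step recursion
  into the quotient of consecutive terms of a confluent series. This lemma and its odd counterpart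
  identify the two halves of the coefficient sequence with the two \<open>hyp_1F1\<close> series of
  \<open>hermite_fun\<close>.\<close>

lemma hermite_coeff_even:
  "hermite_coeff \<tau> (2 * j) = hermite_coeff \<tau> 0 * (pochhammer (- \<tau> / 2) j / pochhammer (1/2) j / fact j)"
proof (induction j)
  case (Suc j)
  have nz: "pochhammer (1/2::complex) j \<noteq> 0" "(1/2::complex) + of_nat j \<noteq> 0"
    "of_nat j + (1::complex) \<noteq> 0" "2 * of_nat j + (1::complex) \<noteq> 0" "2 * of_nat j + (2::complex) \<noteq> 0"
    using complex_of_nat_add_nonzero[of "1/2" j] complex_of_nat_add_nonzero[of 1 j]
      complex_of_nat_add_nonzero[of 1 "2*j"] complex_of_nat_add_nonzero[of 2 "2*j"]
      pochhammer_nonzero[of "1/2" j] by auto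
  have r: "2 * (of_nat (2*j) - \<tau>) / ((of_nat (2*j) + 1) * (of_nat (2*j) + 2))
      = (- \<tau> / 2 + of_nat j) / ((1/2 + of_nat j) * (1 + of_nat j))"
  proof -
    have "(1/2::complex) + of_nat j = (2 * of_nat j + 1)/2" "(1::complex) + of_nat j = (2 * of_nat j + 2)/2"
      by (simp_all add: field_simps)
    thus ?thesis using nz by (simp add: divide_simps del: of_nat_Suc) (simp add: algebra_simps)
  qed
  have "hermite_coeff \<tau> (2 * Suc j) = hermite_coeff \<tau> (Suc (Suc (2*j)))" by simp
  also have "\<dots> = (- \<tau> / 2 + of_nat j) / ((1/2 + of_nat j) * (1 + of_nat j)) * hermite_coeff \<tau> (2*j)"
    by (simp only: hermite_coeff.simps(3) r)
  also have "\<dots> = hermite_coeff \<tau> 0 * (pochhammer (- \<tau> / 2) (Suc j) / pochhammer (1/2) (Suc j) / fact (Suc j))"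
    unfolding Suc pochhammer_Suc fact_Suc of_nat_Suc by (simp add: mult_ac del: hermite_coeff.simps)
  finally show ?case .
qed simp

lemma hermite_coeff_odd:
  "hermite_coeff \<tau> (Suc (2 * j)) =
     hermite_coeff \<tau> (Suc 0) * (pochhammer ((1 - \<tau>) / 2) j / pochhammer (3/2) j / fact j)"
proof (induction j)
  case (Suc j)
  have nz: "2 * of_nat j + (3::complex) \<noteq> 0" "2 * of_nat j + (2::complex) \<noteq> 0" "1 + of_nat j \<noteq> (0::complex)"
    using complex_of_nat_add_nonzero[of 3 "2*j"] complex_of_nat_add_nonzero[of 2 "2*j"]
      complex_of_nat_add_nonzero[of 1 j] by auto
  have r: "2 * (of_nat (Suc (2*j)) - \<tau>) / ((of_nat (Suc (2*j)) + 1) * (of_nat (Suc (2*j)) + 2))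
      = ((1 - \<tau>) / 2 + of_nat j) / ((3/2 + of_nat j) * (1 + of_nat j))"
  proof -
    have "(3/2::complex) + of_nat j = (2 * of_nat j + 3)/2" "(1::complex) + of_nat j = (2 * of_nat j + 2)/2"
      "of_nat (Suc (2*j)) + (1::complex) = 2 * of_nat j + 2"
      "of_nat (Suc (2*j)) + (2::complex) = 2 * of_nat j + 3"
      by (simp_all add: field_simps)
    thus ?thesis using nz by (simp add: divide_simps) (simp add: algebra_simps)
  qed
  have "hermite_coeff \<tau> (Suc (2 * Suc j)) = hermite_coeff \<tau> (Suc (Suc (Suc (2*j))))" by simp
  also have "\<dots> = ((1 - \<tau>) / 2 + of_nat j) / ((3/2 + of_nat j) * (1 + of_nat j)) * hermite_coeff \<tau> (Suc (2*j))"
    by (simp only: hermite_coeff.simps(3) r)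
  also have "\<dots> = hermite_coeff \<tau> (Suc 0) * (pochhammer ((1 - \<tau>) / 2) (Suc j) / pochhammer (3/2) (Suc j) / fact (Suc j))"
    unfolding Suc pochhammer_Suc fact_Suc of_nat_Suc by (simp add: mult_ac del: hermite_coeff.simps)
  finally show ?case .
qed simp

lemma hermite_fun_sums: "(\<lambda>k. hermite_coeff \<tau> k * z ^ k) sums hermite_fun \<tau> z"
proof -
  \<comment> \<open>The even and odd halves are padded with zeros, so that each series in z^2
    reindexes to a power series in z and the two can be added termwise.\<close>
  define f where "f = (\<lambda>k. if even k then hermite_coeff \<tau> k * z ^ k else 0)"
  define g where "g = (\<lambda>k. if odd k then hermite_coeff \<tau> k * z ^ k else 0)"
  have "(\<lambda>k. hermite_coeff \<tau> 0 * (pochhammer (- \<tau> / 2) k / pochhammer (1/2) k * ((z\<^sup>2) ^ k / fact k)))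
      sums (hermite_coeff \<tau> 0 * hyp_1F1 (- \<tau> / 2) (1/2) (z\<^sup>2))"
    unfolding hyp_1F1_def by (intro sums_mult summable_sums summable_hyp_1F1) simp
  also have "(\<lambda>k. hermite_coeff \<tau> 0 * (pochhammer (- \<tau> / 2) k / pochhammer (1/2) k * ((z\<^sup>2) ^ k / fact k)))
     = (\<lambda>k. f (2 * k))"
    by (simp add: f_def hermite_coeff_even power_mult del: hermite_coeff.simps) (simp add: mult_ac)
  finally have "f sums (hermite_coeff \<tau> 0 * hyp_1F1 (- \<tau> / 2) (1/2) (z\<^sup>2))"
    by (subst (asm) sums_mono_reindex) (auto simp: f_def strict_mono_def elim!: evenE)
  moreover have "(\<lambda>k. hermite_coeff \<tau> (Suc 0) * z * (pochhammer ((1 - \<tau>) / 2) k / pochhammer (3/2) k * ((z\<^sup>2) ^ k / fact k)))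
      sums (hermite_coeff \<tau> (Suc 0) * z * hyp_1F1 ((1 - \<tau>) / 2) (3/2) (z\<^sup>2))"
    unfolding hyp_1F1_def by (intro sums_mult summable_sums summable_hyp_1F1) simp
  hence "(\<lambda>k. g (Suc (2 * k))) sums (hermite_coeff \<tau> (Suc 0) * z * hyp_1F1 ((1 - \<tau>) / 2) (3/2) (z\<^sup>2))"
    by (simp add: g_def hermite_coeff_odd power_mult del: hermite_coeff.simps) (simp add: mult_ac)
  hence "g sums (hermite_coeff \<tau> (Suc 0) * z * hyp_1F1 ((1 - \<tau>) / 2) (3/2) (z\<^sup>2))"
    by (subst (asm) sums_mono_reindex) (auto simp: g_def strict_mono_def elim!: oddE)
  ultimately have "(\<lambda>k. f k + g k) sums (hermite_coeff \<tau> 0 * hyp_1F1 (- \<tau> / 2) (1/2) (z\<^sup>2) +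
      hermite_coeff \<tau> (Suc 0) * z * hyp_1F1 ((1 - \<tau>) / 2) (3/2) (z\<^sup>2))"
    by (rule sums_add)
  moreover have "(\<lambda>k. f k + g k) = (\<lambda>k. hermite_coeff \<tau> k * z ^ k)"
    by (auto simp: f_def g_def)
  ultimately show ?thesis by (simp add: hermite_fun_def mult_ac)
qed

lemma Gamma_minus_half: "Gamma (- (1/2) :: complex) = - 2 * Gamma (1/2)"
proof -
  have "- (1/2) \<notin> (\<int>\<^sub>\<le>\<^sub>0 :: complex set)"
  proof
    assume "- (1/2) \<in> (\<int>\<^sub>\<le>\<^sub>0 :: complex set)"
    then obtain n :: int where "- (1/2) = complex_of_int n" by (auto elim!: nonpos_Ints_cases)
    hence "- (1/2) = real_of_int n" by (simp add: complex_eq_iff)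
    hence "real_of_int (2 * n) = real_of_int (- 1)" by simp
    hence "2 * n = - 1" by (simp only: of_int_eq_iff)
    thus False by presburger
  qed
  hence "Gamma (- (1/2) + 1 :: complex) = (- (1/2)) * Gamma (- (1/2))"
    by (rule Gamma_plus1)
  thus ?thesis by simp
qed

text \<open>Coefficient form of H' = 2 \<tau> H at degree \<tau> - 1. The induction goes in steps of
  two because the recursion does. The starting cases rest on the functional equation of
  \<open>rGamma\<close>, valid also at the poles of Gamma, and on Gamma(-1/2) = -2
  Gamma(1/2).\<close>

lemma hermite_coeff_shift:
  "(of_nat k + 1) * hermite_coeff \<tau> (Suc k) = 2 * \<tau> * hermite_coeff (\<tau> - 1) k"
proof (induction k rule: induct_nat_012)
  case 0
  have "rGamma (- \<tau> / 2) = - \<tau> / 2 * rGamma (- \<tau> / 2 + 1)"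
    by (rule rGamma_plus1[symmetric])
  moreover have "- \<tau> / 2 + 1 = (1 - (\<tau> - 1)) / 2" by (simp add: field_simps)
  moreover obtain R where "rGamma ((1 - (\<tau> - 1)) / 2) = R" by blast
  ultimately have "hermite_coeff \<tau> (Suc 0) = 2 powr \<tau> * (Gamma (- 1 / 2) * (- \<tau> / 2 * R))"
    "hermite_coeff (\<tau> - 1) 0 = 2 powr (\<tau> - 1) * (Gamma (1 / 2) * R)"
    by (simp_all only: hermite_coeff.simps)
  hence "hermite_coeff \<tau> (Suc 0) = 2 * \<tau> * hermite_coeff (\<tau> - 1) 0"
    by (simp only:) (simp add: Gamma_minus_half powr_diff)
  thus ?case by (simp del: hermite_coeff.simps)
next
  case 1
  have "- (\<tau> - 1) / 2 = (1 - \<tau>) / 2" by simp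
  thus ?case by (simp add: Gamma_minus_half powr_diff)
next
  case (ge2 k)
  have nz: "of_nat k + (1::complex) \<noteq> 0" "of_nat k + (2::complex) \<noteq> 0" "of_nat k + (3::complex) \<noteq> 0"
    using complex_of_nat_add_nonzero[of 1 k] complex_of_nat_add_nonzero[of 2 k]
      complex_of_nat_add_nonzero[of 3 k] by auto
  have c: "hermite_coeff \<tau> (Suc k) = 2 * \<tau> * hermite_coeff (\<tau> - 1) k / (of_nat k + 1)"
    using ge2(1) nz by (simp add: field_simps del: hermite_coeff.simps)
  have "(of_nat (Suc (Suc k)) + 1) * hermite_coeff \<tau> (Suc (Suc (Suc k)))
     = (of_nat k + 3) * (2 * (of_nat k + 1 - \<tau>) / ((of_nat k + 2) * (of_nat k + 3)) *
          (2 * \<tau> * hermite_coeff (\<tau> - 1) k / (of_nat k + 1)))"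
    unfolding hermite_coeff.simps(3) c by (simp add: algebra_simps del: hermite_coeff.simps)
  also have "\<dots> = 2 * \<tau> * (2 * (of_nat k + 1 - \<tau>) / ((of_nat k + 1) * (of_nat k + 2)) * hermite_coeff (\<tau> - 1) k)"
    using nz by (simp add: divide_simps del: hermite_coeff.simps)
  also have "\<dots> = 2 * \<tau> * hermite_coeff (\<tau> - 1) (Suc (Suc k))"
    unfolding hermite_coeff.simps(3) by (simp add: algebra_simps)
  finally show ?case .
qed

lemma has_field_derivative_hermite_fun:
  "(hermite_fun \<tau> has_field_derivative 2 * \<tau> * hermite_fun (\<tau> - 1) z) (at z)"
proof -
  have H: "hermite_fun \<tau> = (\<lambda>z. \<Sum>k. hermite_coeff \<tau> k * z ^ k)" for \<tau>
    using hermite_fun_sums sums_unique by fast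
  have "((\<lambda>z. \<Sum>k. hermite_coeff \<tau> k * z ^ k) has_field_derivative
      (\<Sum>k. diffs (hermite_coeff \<tau>) k * z ^ k)) (at z)"
    by (rule termdiffs_strong_converges_everywhere) (rule sums_summable[OF hermite_fun_sums])
  also have "diffs (hermite_coeff \<tau>) = (\<lambda>k. 2 * \<tau> * hermite_coeff (\<tau> - 1) k)"
    using hermite_coeff_shift[of _ \<tau>]
    by (simp add: diffs_def fun_eq_iff add.commute del: hermite_coeff.simps)
  also have "(\<Sum>k. 2 * \<tau> * hermite_coeff (\<tau> - 1) k * z ^ k) = 2 * \<tau> * hermite_fun (\<tau> - 1) z"
    using sums_mult[OF hermite_fun_sums[of "\<tau> - 1" z], of "2 * \<tau>"]
    by (simp add: sums_iff mult_ac)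
  finally show ?thesis unfolding H .
qed

text \<open>Coefficient form of "H at degree \<tau> + 1 is 2 z H - H'" in positive powers of z: the
  shift relation gives the left side from index k, the two-step recursion gives index k + 2 from
  index k.\<close>

lemma hermite_coeff_rec:
  "hermite_coeff (\<tau> + 1) (Suc k) = 2 * hermite_coeff \<tau> k - (of_nat k + 2) * hermite_coeff \<tau> (Suc (Suc k))"
proof -
  have nz: "of_nat k + (1::complex) \<noteq> 0" "of_nat k + (2::complex) \<noteq> 0"
    using complex_of_nat_add_nonzero[of 1 k] complex_of_nat_add_nonzero[of 2 k] by auto
  have "hermite_coeff (\<tau> + 1) (Suc k) = 2 * (\<tau> + 1) * hermite_coeff \<tau> k / (of_nat k + 1)"
    using hermite_coeff_shift[of k "\<tau> + 1"] nz by (simp add: field_simps)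
  thus ?thesis using nz by (simp add: divide_simps) (simp add: algebra_simps)
qed

lemma hermite_fun_plus1:
  "hermite_fun (\<tau> + 1) z = 2 * z * hermite_fun \<tau> z - 2 * \<tau> * hermite_fun (\<tau> - 1) z"
proof -
  let ?c = "hermite_coeff"
  have "(\<lambda>k. z * (2 * (?c \<tau> k * z ^ k))) sums (z * (2 * hermite_fun \<tau> z))"
    by (intro sums_mult hermite_fun_sums)
  hence "(\<lambda>k. 2 * ?c \<tau> k * z ^ Suc k) sums (2 * z * hermite_fun \<tau> z)"
    by (simp add: mult_ac)
  moreover have "(\<lambda>k. 2 * \<tau> * (?c (\<tau> - 1) k * z ^ k)) sums (2 * \<tau> * hermite_fun (\<tau> - 1) z)"
    by (intro sums_mult hermite_fun_sums)
  hence "(\<lambda>k. 2 * \<tau> * (?c (\<tau> - 1) (Suc k) * z ^ Suc k)) sums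
      (2 * \<tau> * hermite_fun (\<tau> - 1) z - 2 * \<tau> * ?c (\<tau> - 1) 0)"
    by (subst sums_Suc_iff) simp
  ultimately have "(\<lambda>k. 2 * ?c \<tau> k * z ^ Suc k - 2 * \<tau> * (?c (\<tau> - 1) (Suc k) * z ^ Suc k)) sums
      (2 * z * hermite_fun \<tau> z - (2 * \<tau> * hermite_fun (\<tau> - 1) z - 2 * \<tau> * ?c (\<tau> - 1) 0))"
    by (rule sums_diff)
  also have "(\<lambda>k. 2 * ?c \<tau> k * z ^ Suc k - 2 * \<tau> * (?c (\<tau> - 1) (Suc k) * z ^ Suc k))
     = (\<lambda>k. ?c (\<tau> + 1) (Suc k) * z ^ Suc k)"
  proof
    fix k
    have "2 * \<tau> * ?c (\<tau> - 1) (Suc k) = (of_nat k + 2) * ?c \<tau> (Suc (Suc k))"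
      using hermite_coeff_shift[of "Suc k" \<tau>] by (simp del: hermite_coeff.simps add: add_ac)
    moreover have "2 * ?c \<tau> k * z ^ Suc k - 2 * \<tau> * (?c (\<tau> - 1) (Suc k) * z ^ Suc k)
        = (2 * ?c \<tau> k - 2 * \<tau> * ?c (\<tau> - 1) (Suc k)) * z ^ Suc k"
      by (simp add: algebra_simps del: hermite_coeff.simps)
    ultimately show "2 * ?c \<tau> k * z ^ Suc k - 2 * \<tau> * (?c (\<tau> - 1) (Suc k) * z ^ Suc k)
        = ?c (\<tau> + 1) (Suc k) * z ^ Suc k"
      by (simp only: hermite_coeff_rec)
  qed
  finally have "(\<lambda>k. ?c (\<tau> + 1) (Suc k) * z ^ Suc k) sums
      (2 * z * hermite_fun \<tau> z - (2 * \<tau> * hermite_fun (\<tau> - 1) z - 2 * \<tau> * ?c (\<tau> - 1) 0))" .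
  hence "(\<lambda>k. ?c (\<tau> + 1) k * z ^ k) sums
      (2 * z * hermite_fun \<tau> z - (2 * \<tau> * hermite_fun (\<tau> - 1) z - 2 * \<tau> * ?c (\<tau> - 1) 0) + ?c (\<tau> + 1) 0)"
    by (subst (asm) sums_Suc_iff) simp
  \<comment> \<open>The constant term is not covered by \<open>hermite_coeff_rec\<close>; it follows
    from Gamma(-1/2) = -2 Gamma(1/2) and the shift relation at index 0.\<close>
  moreover have "?c (\<tau> + 1) 0 = - 2 * \<tau> * ?c (\<tau> - 1) 0"
  proof -
    have "?c (\<tau> + 1) 0 = - ?c \<tau> (Suc 0)"
      by (simp add: Gamma_minus_half powr_add)
    thus ?thesis using hermite_coeff_shift[of 0 \<tau>] by simp
  qed
  ultimately show ?thesis
    using hermite_fun_sums[of "\<tau> + 1" z] by (simp add: sums_iff del: hermite_coeff.simps)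
qed

lemma holomorphic_hermite_fun [holomorphic_intros]: "hermite_fun \<tau> holomorphic_on S"
  using has_field_derivative_hermite_fun[of \<tau>] holomorphic_on_open[of UNIV "hermite_fun \<tau>"]
  by (blast intro: holomorphic_on_subset)

text \<open>The product rule leaves (2 \<tau> H at degree \<tau> - 1) - 2 z H, which the three-term
  recurrence collapses to a single Hermite function. This is what makes the later integration by
  parts close up.\<close>

lemma has_field_derivative_hermite_weighted:
  "((\<lambda>z. hermite_fun \<tau> z * exp (- z\<^sup>2)) has_field_derivative - (hermite_fun (\<tau> + 1) z * exp (- z\<^sup>2))) (at z)"
  unfolding hermite_fun_plus1
  by (auto intro!: derivative_eq_intros has_field_derivative_hermite_fun simp: algebra_simps)

subsection \<open>Integral representation and growth\<close>

text \<open>Lebesgue measure is the completion of Borel measure, so the two notions agree for Borel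
  functions. This links the known Gamma integrals and the change of variables, stated for absolute
  integrability, with \<open>lborel\<close>, where Fubini is applied.\<close>

lemma set_integral_lborel_conv_lebesgue:
  fixes f :: "real \<Rightarrow> complex"
  assumes f: "f \<in> borel_measurable borel" and S: "S \<in> sets borel"
  shows "set_integrable lborel S f \<longleftrightarrow> f absolutely_integrable_on S"
    and "f absolutely_integrable_on S \<Longrightarrow> (LBINT x:S. f x) = integral S f"
proof -
  have m: "(\<lambda>x. indicat_real S x *\<^sub>R f x) \<in> borel_measurable lborel"
    using assms by measurable
  show 1: "set_integrable lborel S f \<longleftrightarrow> f absolutely_integrable_on S"
    unfolding set_integrable_def using integrable_completion[OF m] by simp
  assume "f absolutely_integrable_on S"
  thus "(LBINT x:S. f x) = integral S f"
    using integral_completion[OF m] set_lebesgue_integral_eq_integral(2)[of S f]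
    unfolding set_lebesgue_integral_def by simp
qed

lemma Gamma_lborel:
  fixes a :: complex
  assumes a: "Re a > -1"
  shows "set_integrable lborel {0<..} (\<lambda>t. of_real t powr a * of_real (exp (- t)))"
    and "(LBINT t:{0<..}. of_real t powr a * of_real (exp (- t))) = Gamma (a + 1)"
proof -
  have m: "(\<lambda>t::real. complex_of_real t powr a * of_real (exp (- t))) \<in> borel_measurable borel"
    unfolding powr_def by measurable
  have eq: "(\<lambda>t::real. complex_of_real t powr a * of_real (exp (- t))) = (\<lambda>t. complex_of_real t powr ((a + 1) - 1) / of_real (exp t))"
    by (auto simp: exp_minus field_simps)
  have ai: "(\<lambda>t::real. complex_of_real t powr a * of_real (exp (- t))) absolutely_integrable_on {0<..}"
    unfolding eq by (rule absolutely_integrable_Gamma_integral') (use a in simp)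
  show "set_integrable lborel {0<..} (\<lambda>t. of_real t powr a * of_real (exp (- t)))"
    using set_integral_lborel_conv_lebesgue(1)[OF m, of "{0<..}"] ai by auto
  show "(LBINT t:{0<..}. of_real t powr a * of_real (exp (- t))) = Gamma (a + 1)"
    using set_integral_lborel_conv_lebesgue(2)[OF m, of "{0<..}"] ai
      Gamma_integral_complex'[of "a + 1"] a unfolding eq by (auto dest: integral_unique)
qed

text \<open>Substitution u = x^2 in Euler's integral for Gamma at (a + 1)/2: the Jacobian 2x times
  (x^2) to the power (a + 1)/2 - 1 is 2 times x to the power a.\<close>

lemma Gamma_gauss_lborel:
  fixes a :: complex
  assumes a: "Re a > -1"
  shows "set_integrable lborel {0<..} (\<lambda>t. of_real t powr a * of_real (exp (- t\<^sup>2)))"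
    and "(LBINT t:{0<..}. of_real t powr a * of_real (exp (- t\<^sup>2))) = Gamma ((a + 1) / 2) / 2"
proof -
  let ?s = "(a + 1) / 2"
  let ?g = "\<lambda>t::real. complex_of_real t powr a * of_real (exp (- t\<^sup>2))"
  let ?f = "\<lambda>t. complex_of_real t powr (?s - 1) / of_real (exp t)"
  have m: "?g \<in> borel_measurable borel"
    unfolding powr_def by measurable
  have s: "Re ?s > 0" using a by simp
  have img: "(\<lambda>x::real. x\<^sup>2) ` {0<..} = {0<..}"
  proof (intro equalityI subsetI)
    fix y :: real assume "y \<in> {0<..}"
    thus "y \<in> (\<lambda>x. x\<^sup>2) ` {0<..}" by (intro image_eqI[of _ _ "sqrt y"]) auto
  qed auto
  have "?f absolutely_integrable_on (\<lambda>x. x\<^sup>2) ` {0<..} \<and> integral ((\<lambda>x. x\<^sup>2) ` {0<..}) ?f = Gamma ?s"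
    unfolding img using absolutely_integrable_Gamma_integral'[OF s] Gamma_integral_complex'[OF s]
    by (auto dest: integral_unique)
  hence "(\<lambda>x. \<bar>2 * x\<bar> *\<^sub>R ?f (x\<^sup>2)) absolutely_integrable_on {0<..} \<and>
      integral {0<..} (\<lambda>x. \<bar>2 * x\<bar> *\<^sub>R ?f (x\<^sup>2)) = Gamma ?s"
    by (subst has_absolute_integral_change_of_variables_real)
       (auto intro!: derivative_eq_intros inj_onI)
  moreover have "\<bar>2 * x\<bar> *\<^sub>R ?f (x\<^sup>2) = 2 *\<^sub>R ?g x" if "x \<in> {0<..}" for x
  proof -
    from that have x: "x > 0" by simp
    have "complex_of_real (x\<^sup>2) powr (?s - 1) = exp ((?s - 1) * of_real (2 * ln x))"
      using x by (simp add: powr_def Ln_of_real ln_realpow flip: of_real_power)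
    also have "\<dots> = exp (a * of_real (ln x)) * exp (- of_real (ln x))"
      unfolding exp_add[symmetric] by (rule arg_cong[of _ _ exp]) (simp add: field_simps)
    also have "exp (- of_real (ln x)) = 1 / complex_of_real x"
      using x by (simp add: exp_minus exp_of_real divide_simps)
    also have "exp (a * of_real (ln x)) = complex_of_real x powr a"
      using x by (simp add: powr_def Ln_of_real)
    finally have "complex_of_real (x\<^sup>2) powr (?s - 1) = complex_of_real x powr a * (1 / complex_of_real x)" .
    thus ?thesis using x by (simp add: exp_minus scaleR_conv_of_real field_simps)
  qed
  ultimately have g: "(\<lambda>x. 2 *\<^sub>R ?g x) absolutely_integrable_on {0<..} \<and>
      integral {0<..} (\<lambda>x. 2 *\<^sub>R ?g x) = Gamma ?s"
    by (metis (mono_tags, lifting) set_integrable_cong integral_cong)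
  hence ai: "?g absolutely_integrable_on {0<..}"
    by (simp add: absolutely_integrable_on_scaleR_iff)
  have 2: "integral {0<..} ?g = Gamma ?s / 2"
    using g by (simp add: scaleR_conv_of_real field_simps)
  show "set_integrable lborel {0<..} ?g"
    using set_integral_lborel_conv_lebesgue(1)[OF m, of "{0<..}"] ai by auto
  show "(LBINT t:{0<..}. ?g t) = Gamma ?s / 2"
    using set_integral_lborel_conv_lebesgue(2)[OF m, of "{0<..}"] ai 2 by auto
qed

section \<open>Integral representation for degrees with negative real part\<close>

lemma complex_notin_nonpos_Ints: "Re z > 0 \<Longrightarrow> z \<notin> \<int>\<^sub>\<le>\<^sub>0"
  by (auto elim!: nonpos_Ints_cases)

text \<open>Legendre duplication at -\<tau>/2. It merges Gamma(-\<tau>) with the reciprocal Gamma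
  factor in either of the two initial Hermite coefficients into a single Gamma value.\<close>

lemma Gamma_duplication_hermite:
  assumes "Re \<tau> < 0"
  shows "Gamma (- \<tau> / 2) * Gamma ((1 - \<tau>) / 2) = 2 * 2 powr \<tau> * (Gamma (1/2) * Gamma (- \<tau>))"
proof -
  have "Gamma (- \<tau> / 2) * Gamma (- \<tau> / 2 + 1/2) =
      exp ((1 - 2 * (- \<tau> / 2)) * of_real (ln 2)) * of_real (sqrt pi) * Gamma (2 * (- \<tau> / 2))"
    by (rule Gamma_legendre_duplication) (rule complex_notin_nonpos_Ints, use assms in simp)+
  moreover have "exp ((1 - 2 * (- \<tau> / 2)) * of_real (ln 2)) = 2 * 2 powr \<tau>"
    by (simp add: powr_def algebra_simps exp_add exp_of_real flip: Ln_of_real)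
  moreover have "- \<tau> / 2 + 1/2 = (1 - \<tau>) / 2" by (simp add: field_simps)
  ultimately show ?thesis by (simp only: Gamma_one_half_complex) (simp add: mult_ac)
qed

text \<open>The last factor is the Gaussian moment of t to the power k - \<tau> - 1, so the right
  side is what the k-th term of exp(-2tz) contributes under the integral sign. Duplication gives k =
  0 and k = 1; the step is Gamma(x + 1) = x Gamma(x) against the recursion.\<close>

lemma hermite_coeff_moment:
  assumes \<tau>: "Re \<tau> < 0"
  shows "Gamma (- \<tau>) * hermite_coeff \<tau> k = (-2) ^ k / fact k * (Gamma ((of_nat k - \<tau>) / 2) / 2)"
proof (induction k rule: induct_nat_012)
  case 0
  have nz: "Gamma ((1 - \<tau>) / 2) \<noteq> 0"
    using complex_notin_nonpos_Ints[of "(1 - \<tau>) / 2"] \<tau> by (simp add: Gamma_eq_zero_iff)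
  show ?case using Gamma_duplication_hermite[OF \<tau>] nz by (simp add: rGamma_inverse_Gamma field_simps)
next
  case 1
  have nz: "Gamma (- \<tau> / 2) \<noteq> 0"
    using complex_notin_nonpos_Ints[of "- \<tau> / 2"] \<tau> by (simp add: Gamma_eq_zero_iff)
  show ?case using Gamma_duplication_hermite[OF \<tau>] nz by (simp add: rGamma_inverse_Gamma Gamma_minus_half field_simps)
next
  case (ge2 k)
  have nz: "of_nat k + (1::complex) \<noteq> 0" "of_nat k + (2::complex) \<noteq> 0"
    using complex_of_nat_add_nonzero[of 1 k] complex_of_nat_add_nonzero[of 2 k] by auto
  have "Gamma ((of_nat k - \<tau>) / 2 + 1) = (of_nat k - \<tau>) / 2 * Gamma ((of_nat k - \<tau>) / 2)"
    by (rule Gamma_plus1) (rule complex_notin_nonpos_Ints, use \<tau> in simp)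
  moreover have "(of_nat k - \<tau>) / 2 + 1 = (of_nat (Suc (Suc k)) - \<tau>) / 2" by (simp add: field_simps)
  ultimately have G: "Gamma ((of_nat (Suc (Suc k)) - \<tau>) / 2) = (of_nat k - \<tau>) / 2 * Gamma ((of_nat k - \<tau>) / 2)"
    by simp
  have "Gamma (- \<tau>) * hermite_coeff \<tau> (Suc (Suc k)) =
      2 * (of_nat k - \<tau>) / ((of_nat k + 1) * (of_nat k + 2)) * (Gamma (- \<tau>) * hermite_coeff \<tau> k)"
    by (simp add: mult_ac)
  also have "\<dots> = 2 * (of_nat k - \<tau>) / ((of_nat k + 1) * (of_nat k + 2)) *
      ((-2) ^ k / fact k * (Gamma ((of_nat k - \<tau>) / 2) / 2))"
    by (simp only: ge2(1))
  also have "\<dots> = (-2) ^ Suc (Suc k) / fact (Suc (Suc k)) * (Gamma ((of_nat (Suc (Suc k)) - \<tau>) / 2) / 2)"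
  proof -
    have "fact (Suc (Suc k)) = (of_nat k + 2) * ((of_nat k + 1) * (fact k :: complex))"
      by (simp add: algebra_simps)
    thus ?thesis unfolding G using nz by (simp add: divide_simps del: fact_Suc of_nat_Suc)
  qed
  finally show ?case .
qed

text \<open>Expand exp(-2tz) in powers of z, integrate term by term, and recognise the Hermite
  series through \<open>hermite_coeff_moment\<close>.\<close>

lemma hermite_fun_integral:
  assumes \<tau>: "Re \<tau> < 0"
  shows "set_integrable lborel {0<..} (\<lambda>t. of_real t powr (- \<tau> - 1) * exp (- (of_real t)\<^sup>2 - 2 * of_real t * z))"
    and "Gamma (- \<tau>) * hermite_fun \<tau> z =
      (LBINT t:{0<..}. of_real t powr (- \<tau> - 1) * exp (- (of_real t)\<^sup>2 - 2 * of_real t * z))"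
proof -
  define f where "f = (\<lambda>k (t::real). ((-2 * z) ^ k / fact k) *
      (indicat_real {0<..} t *\<^sub>R (of_real t powr (of_nat k - \<tau> - 1) * complex_of_real (exp (- t\<^sup>2)))))"
  define F where "F = (\<lambda>t::real. indicat_real {0<..} t *\<^sub>R
      (of_real t powr (- \<tau> - 1) * exp (- (of_real t)\<^sup>2 - 2 * of_real t * z)))"
  have int: "integrable lborel (f k)" for k
    using Gamma_gauss_lborel(1)[of "of_nat k - \<tau> - 1"] \<tau>
    unfolding f_def set_integrable_def by (intro integrable_mult_right) simp
  have val: "integral\<^sup>L lborel (f k) = Gamma (- \<tau>) * hermite_coeff \<tau> k * z ^ k" for k
  proof -
    have "integral\<^sup>L lborel (f k) = ((-2 * z) ^ k / fact k) * (Gamma ((of_nat k - \<tau> - 1 + 1) / 2) / 2)"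
      unfolding f_def integral_mult_right_zero
      by (subst Gamma_gauss_lborel(2)[unfolded set_lebesgue_integral_def]) (use \<tau> in simp_all)
    also have "\<dots> = ((-2) ^ k / fact k * (Gamma ((of_nat k - \<tau>) / 2) / 2)) * z ^ k"
      unfolding power_mult_distrib by simp
    finally show ?thesis using hermite_coeff_moment[OF \<tau>, of k] by simp
  qed
  \<comment> \<open>The integrals of the norms are again moments: they are the terms of the Hermite
    series of degree \<open>Re \<tau>\<close> at the point -|z|, up to the factor
    Gamma(-\<open>Re \<tau>\<close>). Convergence of that series therefore justifies the
    interchange.\<close>
  have nval: "complex_of_real (\<integral>t. norm (f k t) \<partial>lborel) =
      Gamma (- of_real (Re \<tau>)) * (hermite_coeff (of_real (Re \<tau>)) k * (- of_real (cmod z)) ^ k)" for k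
  proof -
    have *: "complex_of_real (norm (f k t)) = ((2 * cmod z) ^ k / fact k) *
      (indicat_real {0<..} t *\<^sub>R (of_real t powr (of_nat k - of_real (Re \<tau>) - 1) * complex_of_real (exp (- t\<^sup>2))))" for t
    proof (cases "t > 0")
      case True
      have "norm (f k t) = (2 * cmod z) ^ k / fact k * (t powr (real k - Re \<tau> - 1) * exp (- t\<^sup>2))"
        using True by (simp add: f_def norm_mult norm_divide norm_power norm_powr_real_powr)
      moreover have "complex_of_real t powr (of_nat k - of_real (Re \<tau>) - 1) = of_real (t powr (real k - Re \<tau> - 1))"
        using True powr_of_real[of t "real k - Re \<tau> - 1"] by simp
      ultimately show ?thesis using True by simp
    qed (simp add: f_def)
    have "complex_of_real (\<integral>t. norm (f k t) \<partial>lborel) = (\<integral>t. complex_of_real (norm (f k t)) \<partial>lborel)"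
      by simp
    also have "\<dots> = complex_of_real ((2 * cmod z) ^ k / fact k) * (Gamma ((of_nat k - of_real (Re \<tau>) - 1 + 1) / 2) / 2)"
    proof -
      have "-1 < Re (of_nat k - of_real (Re \<tau>) - 1)" using \<tau> by simp
      from Gamma_gauss_lborel(2)[OF this, unfolded set_lebesgue_integral_def]
      show ?thesis unfolding * integral_mult_right_zero by (rule arg_cong)
    qed
    also have "\<dots> = ((-2) ^ k / fact k * (Gamma ((of_nat k - of_real (Re \<tau>)) / 2) / 2)) * (- of_real (cmod z)) ^ k"
    proof -
      have "(-2) ^ k * (- of_real (cmod z)) ^ k = (complex_of_real (2 * cmod z)) ^ k"
        unfolding power_mult_distrib[symmetric] by simp
      hence "complex_of_real ((2 * cmod z) ^ k / fact k) = (-2) ^ k / fact k * (- of_real (cmod z)) ^ k"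
        by simp
      moreover have "of_nat k - of_real (Re \<tau>) - 1 + 1 = of_nat k - complex_of_real (Re \<tau>)" by simp
      ultimately show ?thesis by (simp only: mult.commute mult.left_commute mult.assoc)
    qed
    also have "\<dots> = Gamma (- of_real (Re \<tau>)) * hermite_coeff (of_real (Re \<tau>)) k * (- of_real (cmod z)) ^ k"
    proof -
      have "Re (of_real (Re \<tau>)) < 0" using \<tau> by simp
      from hermite_coeff_moment[OF this, of k] show ?thesis by (simp only:)
    qed
    finally show ?thesis by (simp only: mult.assoc)
  qed
  have sumnorm: "summable (\<lambda>k. \<integral>t. norm (f k t) \<partial>lborel)"
  proof -
    have "summable (\<lambda>k. complex_of_real (\<integral>t. norm (f k t) \<partial>lborel))"
      unfolding nval by (intro summable_mult sums_summable[OF hermite_fun_sums])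
    from summable_Re[OF this] show ?thesis by simp
  qed
  have fs: "(\<lambda>k. f k t) sums F t" and fsn: "summable (\<lambda>k. norm (f k t))" for t
  proof -
    \<comment> \<open>Up to a factor independent of k these are the terms of the exponential series
      at -2tz, so they sum back to \<open>F t\<close>.\<close>
    have *: "f k t = F t * exp (2 * of_real t * z) * ((- 2 * of_real t * z) ^ k /\<^sub>R fact k)" for k
    proof (cases "t > 0")
      case True
      have "complex_of_real t powr (of_nat k - \<tau> - 1) = of_real t powr (- \<tau> - 1) * of_real t ^ k"
      proof -
        have "of_nat k - \<tau> - 1 = (- \<tau> - 1) + of_nat k" by simp
        thus ?thesis using True by (simp only: powr_add) (simp add: powr_nat')
      qed
      moreover have "exp (- (of_real t)\<^sup>2 - 2 * of_real t * z) * exp (2 * of_real t * z) = complex_of_real (exp (- t\<^sup>2))"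
        by (simp flip: exp_add exp_of_real)
      moreover have "(- 2 * of_real t * z) ^ k = (-2 * z) ^ k * of_real t ^ k"
        unfolding power_mult_distrib by simp
      ultimately show ?thesis using True
        by (simp only: f_def F_def) (simp add: scaleR_conv_of_real divide_inverse mult_ac)
    qed (simp add: f_def F_def)
    have "(\<lambda>k. f k t) sums (F t * exp (2 * of_real t * z) * exp (- 2 * of_real t * z))"
      unfolding * by (intro sums_mult exp_converges)
    thus "(\<lambda>k. f k t) sums F t" by (simp add: exp_minus mult.assoc)
    show "summable (\<lambda>k. norm (f k t))"
      unfolding * norm_mult by (intro summable_mult summable_norm_exp)
  qed
  have Feq: "(\<lambda>t. \<Sum>k. f k t) = F" using fs by (simp add: sums_iff fun_eq_iff)
  have "integrable lborel (\<lambda>t. \<Sum>k. f k t)"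
    by (rule integrable_suminf) (use int fsn sumnorm in auto)
  thus "set_integrable lborel {0<..} (\<lambda>t. of_real t powr (- \<tau> - 1) * exp (- (of_real t)\<^sup>2 - 2 * of_real t * z))"
    unfolding Feq by (simp add: F_def set_integrable_def)
  have "(\<lambda>k. integral\<^sup>L lborel (f k)) sums (\<integral>t. (\<Sum>k. f k t) \<partial>lborel)"
    by (rule sums_integral) (use int fsn sumnorm in auto)
  hence "(\<lambda>k. Gamma (- \<tau>) * (hermite_coeff \<tau> k * z ^ k)) sums integral\<^sup>L lborel F"
    unfolding Feq val by (simp add: mult_ac)
  moreover have "(\<lambda>k. Gamma (- \<tau>) * (hermite_coeff \<tau> k * z ^ k)) sums (Gamma (- \<tau>) * hermite_fun \<tau> z)"
    by (intro sums_mult hermite_fun_sums)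
  ultimately have "Gamma (- \<tau>) * hermite_fun \<tau> z = integral\<^sup>L lborel F" by (rule sums_unique2[rotated])
  thus "Gamma (- \<tau>) * hermite_fun \<tau> z =
      (LBINT t:{0<..}. of_real t powr (- \<tau> - 1) * exp (- (of_real t)\<^sup>2 - 2 * of_real t * z))"
    by (simp add: F_def set_lebesgue_integral_def)
qed

section \<open>Polynomial growth in the right half-plane\<close>

text \<open>For \<open>Re z\<close> nonnegative and t positive, exp(-2tz) has modulus at most 1, so
  the integrand at z = 0 dominates all the others.\<close>

lemma hermite_fun_bound_neg:
  assumes \<tau>: "Re \<tau> < 0"
  shows "\<exists>A. \<forall>z. Re z \<ge> 0 \<longrightarrow> cmod (hermite_fun \<tau> z) \<le> A"
proof -
  let ?F = "\<lambda>z t. of_real t powr (- \<tau> - 1) * exp (- (of_real t)\<^sup>2 - 2 * of_real t * z)"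
  define B where "B = (LBINT t:{0<..}. norm (?F 0 t))"
  have G: "Gamma (- \<tau>) \<noteq> 0"
    using complex_notin_nonpos_Ints[of "- \<tau>"] \<tau> by (simp add: Gamma_eq_zero_iff)
  have "cmod (hermite_fun \<tau> z) \<le> B / cmod (Gamma (- \<tau>))" if z: "Re z \<ge> 0" for z
  proof -
    have "cmod (Gamma (- \<tau>)) * cmod (hermite_fun \<tau> z) = norm (LBINT t:{0<..}. ?F z t)"
      using hermite_fun_integral(2)[OF \<tau>, of z] by (metis norm_mult)
    also have "\<dots> \<le> (LBINT t:{0<..}. norm (?F z t))"
      by (rule set_integral_norm_bound) (rule hermite_fun_integral(1)[OF \<tau>])
    also have "\<dots> \<le> B"
      unfolding B_def
    proof (rule set_integral_mono)
      show "set_integrable lborel {0<..} (\<lambda>t. norm (?F z t))" "set_integrable lborel {0<..} (\<lambda>t. norm (?F 0 t))"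
        by (intro set_integrable_norm hermite_fun_integral(1)[OF \<tau>])+
      fix t :: real assume "t \<in> {0<..}"
      thus "norm (?F z t) \<le> norm (?F 0 t)" using z by (auto simp: norm_mult intro!: mult_left_mono)
    qed
    finally show ?thesis using G by (simp add: field_simps)
  qed
  thus ?thesis by blast
qed

text \<open>The derivative \<open>H\<^sub>\<tau>' = 2\<tau> H\<^sub>\<tau>\<^sub>-\<^sub>1\<close> carries the bound from \<open>Re \<tau> < n\<close> to \<open>Re \<tau> < n + 1\<close>.\<close>

lemma hermite_fun_poly_bound_aux:
  assumes "Re \<tau> < of_nat n"
  shows "\<exists>A\<ge>0. \<forall>z. Re z \<ge> 0 \<longrightarrow> cmod (hermite_fun \<tau> z) \<le> A * (1 + cmod z) ^ n"
  using assms
proof (induction n arbitrary: \<tau>)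
  case 0
  then obtain A where A: "\<And>z. Re z \<ge> 0 \<Longrightarrow> cmod (hermite_fun \<tau> z) \<le> A"
    using hermite_fun_bound_neg[of \<tau>] by auto
  have "0 \<le> cmod (hermite_fun \<tau> 0)" by simp
  also have "\<dots> \<le> A" by (rule A) simp
  finally show ?case using A by auto
next
  case (Suc n)
  from Suc.IH[of "\<tau> - 1"] Suc.prems obtain A where A: "A \<ge> 0"
    "\<And>z. Re z \<ge> 0 \<Longrightarrow> cmod (hermite_fun (\<tau> - 1) z) \<le> A * (1 + cmod z) ^ n" by auto
  define B where "B = cmod (hermite_fun \<tau> 0) + 2 * cmod \<tau> * A"
  have "cmod (hermite_fun \<tau> z) \<le> B * (1 + cmod z) ^ Suc n" if z: "Re z \<ge> 0" for z
  proof -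
    let ?M = "2 * cmod \<tau> * (A * (1 + cmod z) ^ n)"
    have "cmod (hermite_fun \<tau> z - hermite_fun \<tau> 0) \<le> ?M * cmod (z - 0)"
    proof (rule field_differentiable_bound)
      show "convex (closed_segment 0 z)" by simp
      fix w assume w: "w \<in> closed_segment 0 z"
      show "(hermite_fun \<tau> has_field_derivative 2 * \<tau> * hermite_fun (\<tau> - 1) w) (at w within closed_segment 0 z)"
        by (rule has_field_derivative_at_within) (rule has_field_derivative_hermite_fun)
      from w obtain u where u: "0 \<le> u" "u \<le> 1" "w = of_real u * z"
        by (auto simp: closed_segment_def scaleR_conv_of_real)
      have "Re w \<ge> 0" using u z by simp
      hence "cmod (hermite_fun (\<tau> - 1) w) \<le> A * (1 + cmod w) ^ n" by (rule A)
      also have "\<dots> \<le> A * (1 + cmod z) ^ n"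
        using u A(1) by (intro mult_left_mono power_mono) (auto simp: norm_mult intro: mult_left_le_one_le)
      finally have "cmod (hermite_fun (\<tau> - 1) w) \<le> A * (1 + cmod z) ^ n" .
      thus "cmod (2 * \<tau> * hermite_fun (\<tau> - 1) w) \<le> ?M"
        by (simp add: norm_mult mult_left_mono)
    qed auto
    hence "cmod (hermite_fun \<tau> z) \<le> cmod (hermite_fun \<tau> 0) + ?M * cmod z"
      using norm_triangle_sub[of "hermite_fun \<tau> z" "hermite_fun \<tau> 0"] by simp
    also have "\<dots> \<le> cmod (hermite_fun \<tau> 0) * (1 + cmod z) ^ Suc n + ?M * (1 + cmod z)"
    proof (rule add_mono)
      have "1 \<le> (1 + cmod z) ^ Suc n" by (rule one_le_power) simp
      thus "cmod (hermite_fun \<tau> 0) \<le> cmod (hermite_fun \<tau> 0) * (1 + cmod z) ^ Suc n"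
        using mult_left_mono[of 1 "(1 + cmod z) ^ Suc n" "cmod (hermite_fun \<tau> 0)"] by simp
      show "?M * cmod z \<le> ?M * (1 + cmod z)" using A(1) by (intro mult_left_mono) auto
    qed
    also have "\<dots> = B * (1 + cmod z) ^ Suc n" by (simp add: B_def algebra_simps)
    finally show ?thesis .
  qed
  moreover have "B \<ge> 0" using A(1) by (simp add: B_def)
  ultimately show ?case by blast
qed

lemma hermite_fun_poly_bound:
  "\<exists>A n. A \<ge> 0 \<and> (\<forall>z. Re z \<ge> 0 \<longrightarrow> cmod (hermite_fun \<tau> z) \<le> A * (1 + cmod z) ^ n)"
proof -
  obtain n where "Re \<tau> < of_nat n" using reals_Archimedean2 by blast
  thus ?thesis using hermite_fun_poly_bound_aux by blast
qed

subsection \<open>Double integrals and the Mellin transform on the half-line\<close>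

lemma norm_powr_of_real: "x > 0 \<Longrightarrow> norm (complex_of_real x powr a) = x powr Re a"
  by (simp add: norm_powr_real_powr)

lemma powr_mult_of_real:
  assumes "x > 0" "y > 0"
  shows "complex_of_real (x * y) powr a = of_real x powr a * of_real y powr a"
  using assms by (simp add: powr_times_real)

text \<open>The double integral of \<open>x\<^sup>\<alpha> t\<^sup>\<beta> \<phi>(x + t)\<close> is a Beta integral, independent of \<open>\<phi>\<close>, times a moment
  of \<open>\<phi>\<close>. Taking \<open>\<phi> = exp (- x)\<close> evaluates the Beta integral in terms of \<open>\<Gamma>\<close>, and the same identity for
  \<open>\<phi> = exp (- x\<^sup>2)\<close> then gives the Gaussian double integral.\<close>

locale moment_weight =
  fixes \<phi> :: "real \<Rightarrow> real"
  assumes meas [measurable]: "\<phi> \<in> borel_measurable borel"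
    and nonneg: "\<And>x. \<phi> x \<ge> 0"
    and submult: "\<And>x t. x > 0 \<Longrightarrow> t > 0 \<Longrightarrow> \<phi> (x + t) \<le> \<phi> x * \<phi> t"
    and moments: "\<And>a::complex. Re a > -1 \<Longrightarrow> set_integrable lborel {0<..} (\<lambda>t. of_real t powr a * of_real (\<phi> t))"
begin

lemma real_moments:
  assumes "a > (-1::real)"
  shows "set_integrable lborel {0<..} (\<lambda>t. t powr a * \<phi> t)"
proof -
  have "set_integrable lborel {0<..} (\<lambda>t. norm (of_real t powr (of_real a :: complex) * of_real (\<phi> t)))"
    by (intro set_integrable_norm moments) (use assms in simp)
  also have "?this \<longleftrightarrow> ?thesis"
    by (intro set_integrable_cong refl) (auto simp: norm_mult norm_powr_of_real nonneg)
  finally show ?thesis .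
qed

text \<open>The integrand of the double integral in the coordinates x and u = x + t, supported on 0
  < x < u. In these coordinates the weight depends on u alone.\<close>

definition kernel :: "complex \<Rightarrow> complex \<Rightarrow> real \<Rightarrow> real \<Rightarrow> complex" where
  "kernel \<alpha> \<beta> x u = indicat_real {0<..} x *\<^sub>R indicat_real {0<..} (u - x) *\<^sub>R
     (of_real x powr \<alpha> * of_real (u - x) powr \<beta> * of_real (\<phi> u))"

lemma kernel_measurable [measurable]:
  "(\<lambda>(x, u). kernel \<alpha> \<beta> x u) \<in> borel_measurable (lborel \<Otimes>\<^sub>M lborel)"
  unfolding kernel_def powr_def by measurable

lemma kernel_shift: "kernel \<alpha> \<beta> x (x + t) = indicat_real {0<..} x *\<^sub>R (of_real x powr \<alpha> *
    (indicat_real {0<..} t *\<^sub>R (of_real t powr \<beta> * of_real (\<phi> (x + t)))))"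
  by (simp add: kernel_def)

context
  fixes \<alpha> \<beta> :: complex
  assumes \<alpha>: "Re \<alpha> > -1" and \<beta>: "Re \<beta> > -1"
begin

lemma shifted_moment_integrable:
  assumes x: "x > 0"
  shows "set_integrable lborel {0<..} (\<lambda>t. of_real t powr \<beta> * complex_of_real (\<phi> (x + t)))"
proof (rule set_integrable_bound)
  show "set_integrable lborel {0<..} (\<lambda>t. \<phi> x * (t powr Re \<beta> * \<phi> t))"
    by (intro set_integrable_mult_right real_moments \<beta>)
  show "set_borel_measurable lborel {0<..} (\<lambda>t. of_real t powr \<beta> * complex_of_real (\<phi> (x + t)))"
    unfolding set_borel_measurable_def powr_def by measurable
  show "AE t in lborel. t \<in> {0<..} \<longrightarrow> norm (of_real t powr \<beta> * complex_of_real (\<phi> (x + t))) \<le> norm (\<phi> x * (t powr Re \<beta> * \<phi> t))"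
  proof (intro AE_I2 impI)
    fix t :: real assume "t \<in> {0<..}"
    hence t: "t > 0" by simp
    have "t powr Re \<beta> * \<phi> (x + t) \<le> t powr Re \<beta> * (\<phi> x * \<phi> t)"
      by (intro mult_left_mono submult x t) simp
    thus "norm (of_real t powr \<beta> * complex_of_real (\<phi> (x + t))) \<le> norm (\<phi> x * (t powr Re \<beta> * \<phi> t))"
      using t by (simp add: norm_mult norm_powr_of_real nonneg mult_ac)
  qed
qed

lemma kernel_integrable_snd: "integrable lborel (kernel \<alpha> \<beta> x)"
proof (cases "x > 0")
  case True
  have "integrable lborel (\<lambda>t. kernel \<alpha> \<beta> x (x + 1 * t))"
    using shifted_moment_integrable[OF True] unfolding set_integrable_def mult_1 kernel_shift
    by (intro integrable_scaleR_right integrable_mult_right) simp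
  thus ?thesis by (subst (asm) lborel_integrable_real_affine_iff) simp_all
qed (simp add: kernel_def[abs_def])

lemma integral_kernel_snd:
  "(\<integral>u. kernel \<alpha> \<beta> x u \<partial>lborel) = indicat_real {0<..} x *\<^sub>R (of_real x powr \<alpha> *
     (LBINT t:{0<..}. of_real t powr \<beta> * of_real (\<phi> (x + t))))"
proof -
  have "(\<integral>u. kernel \<alpha> \<beta> x u \<partial>lborel) = (\<integral>t. kernel \<alpha> \<beta> x (x + 1 * t) \<partial>lborel)"
    by (subst lborel_integral_real_affine[of 1 _ x]) simp_all
  thus ?thesis
    unfolding mult_1 kernel_shift set_lebesgue_integral_def
    by (simp only: integral_scaleR_right integral_mult_right_zero)
qed

text \<open>For fixed u > 0 the substitution x = us pulls out one power of u from each factor and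
  one u from the Jacobian, which explains the exponent \<alpha> + \<beta> + 1. What remains is a
  Beta integral in which \<phi> no longer occurs.\<close>

lemma integral_kernel_fst:
  "(\<integral>x. kernel \<alpha> \<beta> x u \<partial>lborel) = (LBINT s:{0<..<1}. of_real s powr \<alpha> * of_real (1 - s) powr \<beta>) *
     (indicat_real {0<..} u *\<^sub>R (of_real u powr (\<alpha> + \<beta> + 1) * of_real (\<phi> u)))"
proof (cases "u > 0")
  case True
  have "(\<integral>x. kernel \<alpha> \<beta> x u \<partial>lborel) = u *\<^sub>R (\<integral>s. kernel \<alpha> \<beta> (0 + u * s) u \<partial>lborel)"
    using True by (subst lborel_integral_real_affine[of u _ 0]) simp_all
  also have "(\<lambda>s. kernel \<alpha> \<beta> (0 + u * s) u) = (\<lambda>s. (of_real u powr \<alpha> * of_real u powr \<beta> * of_real (\<phi> u)) *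
      (indicat_real {0<..<1} s *\<^sub>R (of_real s powr \<alpha> * of_real (1 - s) powr \<beta>)))"
  proof
    fix s :: real
    have iff: "0 < u * s \<longleftrightarrow> 0 < s" "0 < u - u * s \<longleftrightarrow> s < 1"
      using True by (simp_all add: zero_less_mult_iff)
    show "kernel \<alpha> \<beta> (0 + u * s) u = (of_real u powr \<alpha> * of_real u powr \<beta> * of_real (\<phi> u)) *
      (indicat_real {0<..<1} s *\<^sub>R (of_real s powr \<alpha> * of_real (1 - s) powr \<beta>))"
    proof (cases "0 < s \<and> s < 1")
      case s: True
      have "of_real (u - u * s) powr \<beta> = of_real u powr \<beta> * complex_of_real (1 - s) powr \<beta>"
        using powr_mult_of_real[of u "1 - s" \<beta>] s True by (simp add: right_diff_distrib)
      moreover have "of_real (u * s) powr \<alpha> = of_real u powr \<alpha> * complex_of_real s powr \<alpha>"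
        using powr_mult_of_real[of u s \<alpha>] s True by simp
      ultimately show ?thesis using s iff unfolding kernel_def by (simp del: of_real_diff of_real_mult)
    next
      case False
      thus ?thesis using iff unfolding kernel_def by auto
    qed
  qed
  also have "u *\<^sub>R (\<integral>s. (of_real u powr \<alpha> * of_real u powr \<beta> * of_real (\<phi> u)) *
      (indicat_real {0<..<1} s *\<^sub>R (of_real s powr \<alpha> * of_real (1 - s) powr \<beta>)) \<partial>lborel) =
     of_real u * (of_real u powr \<alpha> * of_real u powr \<beta> * of_real (\<phi> u)) *
      (LBINT s:{0<..<1}. of_real s powr \<alpha> * of_real (1 - s) powr \<beta>)"
    unfolding integral_mult_right_zero set_lebesgue_integral_def by (simp only: scaleR_conv_of_real mult.assoc)
  also have "of_real u * (of_real u powr \<alpha> * of_real u powr \<beta> * of_real (\<phi> u))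
      = complex_of_real u powr (\<alpha> + \<beta> + 1) * of_real (\<phi> u)"
    using True by (simp add: powr_add)
  finally show ?thesis using True by (simp add: mult_ac)
next
  case False
  hence "kernel \<alpha> \<beta> x u = 0" for x by (auto simp: kernel_def indicator_def)
  thus ?thesis using False by simp
qed

text \<open>Submultiplicativity of \<phi> separates the variables: the inner integral of the norm is
  at most a constant \<open>D\<close> times x to the power \<open>Re \<alpha>\<close> times
  \<open>\<phi> x\<close>, and both are finite moments.\<close>

lemma kernel_integrable: "integrable (lborel \<Otimes>\<^sub>M lborel) (\<lambda>(x, u). kernel \<alpha> \<beta> x u)"
proof (rule lborel_pair.Fubini_integrable)
  define D where "D = (LBINT t:{0<..}. t powr Re \<beta> * \<phi> t)"
  show "integrable lborel (\<lambda>x. \<integral>u. norm ((\<lambda>(x, u). kernel \<alpha> \<beta> x u) (x, u)) \<partial>lborel)"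
  proof (rule Bochner_Integration.integrable_bound)
    show "integrable lborel (\<lambda>x. D * (indicat_real {0<..} x *\<^sub>R (x powr Re \<alpha> * \<phi> x)))"
      using real_moments[OF \<alpha>] unfolding set_integrable_def by (intro integrable_mult_right)
    show "(\<lambda>x. \<integral>u. norm ((\<lambda>(x, u). kernel \<alpha> \<beta> x u) (x, u)) \<partial>lborel) \<in> borel_measurable lborel"
      by measurable
    show "AE x in lborel. norm (\<integral>u. norm ((\<lambda>(x, u). kernel \<alpha> \<beta> x u) (x, u)) \<partial>lborel)
        \<le> norm (D * (indicat_real {0<..} x *\<^sub>R (x powr Re \<alpha> * \<phi> x)))"
    proof (rule AE_I2)
      fix x :: real
      show "norm (\<integral>u. norm ((\<lambda>(x, u). kernel \<alpha> \<beta> x u) (x, u)) \<partial>lborel)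
        \<le> norm (D * (indicat_real {0<..} x *\<^sub>R (x powr Re \<alpha> * \<phi> x)))"
      proof (cases "x > 0")
        case True
        have int: "integrable lborel (\<lambda>t. norm (kernel \<alpha> \<beta> x (x + 1 * t)))"
          using lborel_integrable_real_affine_iff[of 1 "kernel \<alpha> \<beta> x" x] kernel_integrable_snd by auto
        have "(\<integral>u. norm (kernel \<alpha> \<beta> x u) \<partial>lborel) = (\<integral>t. norm (kernel \<alpha> \<beta> x (x + 1 * t)) \<partial>lborel)"
          by (subst lborel_integral_real_affine[of 1 _ x]) simp_all
        also have "\<dots> \<le> (\<integral>t. x powr Re \<alpha> * \<phi> x * (indicat_real {0<..} t *\<^sub>R (t powr Re \<beta> * \<phi> t)) \<partial>lborel)"
        proof (rule integral_mono[OF int])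
          show "integrable lborel (\<lambda>t. x powr Re \<alpha> * \<phi> x * (indicat_real {0<..} t *\<^sub>R (t powr Re \<beta> * \<phi> t)))"
            using real_moments[OF \<beta>] unfolding set_integrable_def by (intro integrable_mult_right)
          fix t :: real
          show "norm (kernel \<alpha> \<beta> x (x + 1 * t)) \<le> x powr Re \<alpha> * \<phi> x * (indicat_real {0<..} t *\<^sub>R (t powr Re \<beta> * \<phi> t))"
          proof (cases "t > 0")
            case t: True
            have "(x powr Re \<alpha> * t powr Re \<beta>) * \<phi> (x + t) \<le> (x powr Re \<alpha> * t powr Re \<beta>) * (\<phi> x * \<phi> t)"
              by (intro mult_left_mono submult True t) simp
            thus ?thesis using t True
              by (simp add: kernel_shift norm_mult norm_powr_of_real nonneg mult_ac)
          qed (simp add: kernel_def)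
        qed
        also have "\<dots> = x powr Re \<alpha> * \<phi> x * D" by (simp add: D_def set_lebesgue_integral_def)
        finally show ?thesis using True by (simp add: nonneg mult_ac)
      qed (simp add: kernel_def)
    qed
  qed
  show "AE x in lborel. integrable lborel (\<lambda>u. (\<lambda>(x, u). kernel \<alpha> \<beta> x u) (x, u))"
    using kernel_integrable_snd by simp
qed measurable

text \<open>Fubini for \<open>kernel\<close>: integrating over u first gives the iterated integral
  in x and t, integrating over x first gives Beta times a moment.\<close>

lemma convolution_moment:
  "set_integrable lborel {0<..} (\<lambda>x. of_real x powr \<alpha> *
       (LBINT t:{0<..}. of_real t powr \<beta> * complex_of_real (\<phi> (x + t))))" (is ?A)
  "(LBINT x:{0<..}. of_real x powr \<alpha> * (LBINT t:{0<..}. of_real t powr \<beta> * complex_of_real (\<phi> (x + t)))) =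
     (LBINT s:{0<..<1}. of_real s powr \<alpha> * of_real (1 - s) powr \<beta>) *
     (LBINT u:{0<..}. of_real u powr (\<alpha> + \<beta> + 1) * of_real (\<phi> u))" (is ?B)
proof -
  have "integrable lborel (\<lambda>x. \<integral>u. kernel \<alpha> \<beta> x u \<partial>lborel)"
    using lborel_pair.integrable_fst'[OF kernel_integrable] by simp
  thus ?A unfolding integral_kernel_snd set_integrable_def .
  have "(\<integral>x. (\<integral>u. kernel \<alpha> \<beta> x u \<partial>lborel) \<partial>lborel) = (\<integral>u. (\<integral>x. kernel \<alpha> \<beta> x u \<partial>lborel) \<partial>lborel)"
    using lborel_pair.Fubini_integral[OF kernel_integrable] by simp
  thus ?B unfolding integral_kernel_snd integral_kernel_fst integral_mult_right_zero
    unfolding set_lebesgue_integral_def .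
qed

end

end

section \<open>The Gaussian double integral and Mellin transforms of Hermite functions\<close>

interpretation exp_weight: moment_weight "\<lambda>x. exp (- x)"
  by standard (auto simp: exp_add[symmetric] intro: Gamma_lborel(1))

interpretation gauss_weight: moment_weight "\<lambda>x. exp (- x\<^sup>2)"
proof
  fix x t :: real assume "x > 0" "t > 0"
  hence "- (x + t)\<^sup>2 \<le> - x\<^sup>2 - t\<^sup>2" by (simp add: power2_sum)
  thus "exp (- (x + t)\<^sup>2) \<le> exp (- x\<^sup>2) * exp (- t\<^sup>2)" by (simp flip: exp_add)
qed (auto intro: Gamma_gauss_lborel(1))

text \<open>The Beta integral \<open>c\<close> is eliminated between the two weights. For the
  exponential weight the double integral factors, which gives \<open>c\<close> times Gamma(\<alpha>
  + \<beta> + 2); keeping this Gamma factor on the left avoids dividing by it.\<close>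

lemma gauss_convolution_moment:
  assumes \<alpha>: "Re \<alpha> > -1" and \<beta>: "Re \<beta> > -1"
  shows "Gamma (\<alpha> + \<beta> + 2) * (LBINT x:{0<..}. of_real x powr \<alpha> *
      (LBINT t:{0<..}. of_real t powr \<beta> * complex_of_real (exp (- (x + t)\<^sup>2)))) =
    Gamma (\<alpha> + 1) * Gamma (\<beta> + 1) * Gamma ((\<alpha> + \<beta> + 2) / 2) / 2"
proof -
  define c where "c = (LBINT s:{0<..<1}. complex_of_real s powr \<alpha> * of_real (1 - s) powr \<beta>)"
  have ab: "Re (\<alpha> + \<beta> + 1) > -1" using assms by simp
  have inner: "(LBINT t:{0<..}. of_real t powr \<beta> * complex_of_real (exp (- (x + t))))
      = of_real (exp (- x)) * Gamma (\<beta> + 1)" for x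
  proof -
    have "(\<lambda>t. of_real t powr \<beta> * complex_of_real (exp (- (x + t)))) =
       (\<lambda>t. of_real (exp (- x)) * (of_real t powr \<beta> * of_real (exp (- t))))"
      by (simp add: exp_diff exp_minus exp_add fun_eq_iff field_simps)
    thus ?thesis using Gamma_lborel(2)[OF \<beta>] by simp
  qed
  have "c * Gamma (\<alpha> + \<beta> + 1 + 1) =
      (LBINT x:{0<..}. of_real x powr \<alpha> * (LBINT t:{0<..}. of_real t powr \<beta> * complex_of_real (exp (- (x + t)))))"
    using exp_weight.convolution_moment(2)[OF assms] Gamma_lborel(2)[OF ab] by (simp add: c_def)
  also have "\<dots> = (LBINT x:{0<..}. Gamma (\<beta> + 1) * (of_real x powr \<alpha> * of_real (exp (- x))))"
    unfolding inner by (simp add: mult_ac)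
  also have "\<dots> = Gamma (\<beta> + 1) * Gamma (\<alpha> + 1)"
    using Gamma_lborel(2)[OF \<alpha>] by simp
  finally have c: "c * Gamma (\<alpha> + \<beta> + 2) = Gamma (\<alpha> + 1) * Gamma (\<beta> + 1)" by (simp add: add_ac mult_ac)
  have "(LBINT x:{0<..}. of_real x powr \<alpha> * (LBINT t:{0<..}. of_real t powr \<beta> * complex_of_real (exp (- (x + t)\<^sup>2))))
     = c * (Gamma ((\<alpha> + \<beta> + 1 + 1) / 2) / 2)"
    using gauss_weight.convolution_moment(2)[OF assms] Gamma_gauss_lborel(2)[OF ab] by (simp add: c_def)
  hence "Gamma (\<alpha> + \<beta> + 2) * (LBINT x:{0<..}. of_real x powr \<alpha> *
      (LBINT t:{0<..}. of_real t powr \<beta> * complex_of_real (exp (- (x + t)\<^sup>2)))) =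
      (c * Gamma (\<alpha> + \<beta> + 2)) * Gamma ((\<alpha> + \<beta> + 2) / 2) / 2"
    by (simp add: add_ac mult_ac)
  thus ?thesis unfolding c .
qed

text \<open>Inserting the integral representation completes the square: the exponent becomes -(x +
  t)^2, and the double integral is the Gaussian one with \<beta> = -\<tau> - 1. The factor
  Gamma(-\<tau>) on both sides is nonzero and cancels.\<close>

lemma hermite_fun_mellin:
  assumes \<tau>: "Re \<tau> < 0" and \<alpha>: "Re \<alpha> > -1"
  shows "set_integrable lborel {0<..} (\<lambda>x. of_real x powr \<alpha> * (hermite_fun \<tau> (of_real x) * exp (- (of_real x)\<^sup>2)))"
    and "Gamma (\<alpha> - \<tau> + 1) * (LBINT x:{0<..}. of_real x powr \<alpha> * (hermite_fun \<tau> (of_real x) * exp (- (of_real x)\<^sup>2)))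
      = Gamma (\<alpha> + 1) * Gamma ((\<alpha> - \<tau> + 1) / 2) / 2"
proof -
  let ?I = "\<lambda>x. of_real x powr \<alpha> * (LBINT t:{0<..}. of_real t powr (- \<tau> - 1) * complex_of_real (exp (- (x + t)\<^sup>2)))"
  let ?J = "\<lambda>x. of_real x powr \<alpha> * (hermite_fun \<tau> (of_real x) * exp (- (of_real x)\<^sup>2))"
  have \<beta>: "Re (- \<tau> - 1) > -1" using \<tau> by simp
  have G: "Gamma (- \<tau>) \<noteq> 0"
    using complex_notin_nonpos_Ints[of "- \<tau>"] \<tau> by (simp add: Gamma_eq_zero_iff)
  have eq: "?I = (\<lambda>x. Gamma (- \<tau>) * ?J x)"
  proof
    fix x :: real
    have "(\<lambda>t. of_real t powr (- \<tau> - 1) * complex_of_real (exp (- (x + t)\<^sup>2))) =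
      (\<lambda>t. exp (- (of_real x)\<^sup>2) * (of_real t powr (- \<tau> - 1) * exp (- (of_real t)\<^sup>2 - 2 * of_real t * of_real x)))"
    proof
      fix t :: real
      have "complex_of_real (exp (- (x + t)\<^sup>2)) = exp (- (of_real x)\<^sup>2) * exp (- (of_real t)\<^sup>2 - 2 * of_real t * of_real x)"
        by (simp add: power2_sum algebra_simps flip: exp_add exp_of_real)
      thus "of_real t powr (- \<tau> - 1) * complex_of_real (exp (- (x + t)\<^sup>2)) =
        exp (- (of_real x)\<^sup>2) * (of_real t powr (- \<tau> - 1) * exp (- (of_real t)\<^sup>2 - 2 * of_real t * of_real x))"
        by (simp only: mult_ac)
    qed
    hence "(LBINT t:{0<..}. of_real t powr (- \<tau> - 1) * complex_of_real (exp (- (x + t)\<^sup>2))) =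
       exp (- (of_real x)\<^sup>2) * (Gamma (- \<tau>) * hermite_fun \<tau> (of_real x))"
      using hermite_fun_integral(2)[OF \<tau>, of "of_real x"] by simp
    thus "?I x = Gamma (- \<tau>) * ?J x" by (simp only: mult_ac)
  qed
  have "set_integrable lborel {0<..} (\<lambda>x. inverse (Gamma (- \<tau>)) * (Gamma (- \<tau>) * ?J x))"
    using gauss_weight.convolution_moment(1)[OF \<alpha> \<beta>] unfolding eq by (intro set_integrable_mult_right) simp
  thus "set_integrable lborel {0<..} ?J" using G by simp
  have "Gamma (\<alpha> + (- \<tau> - 1) + 2) * (Gamma (- \<tau>) * (LBINT x:{0<..}. ?J x)) =
      Gamma (\<alpha> + 1) * Gamma (- \<tau> - 1 + 1) * Gamma ((\<alpha> + (- \<tau> - 1) + 2) / 2) / 2"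
    using gauss_convolution_moment[OF \<alpha> \<beta>] unfolding eq by simp
  moreover have "\<alpha> + (- \<tau> - 1) + 2 = \<alpha> - \<tau> + 1" "- \<tau> - 1 + 1 = - \<tau>" by simp_all
  ultimately have "Gamma (- \<tau>) * (Gamma (\<alpha> - \<tau> + 1) * (LBINT x:{0<..}. ?J x)) =
      Gamma (- \<tau>) * (Gamma (\<alpha> + 1) * Gamma ((\<alpha> - \<tau> + 1) / 2) / 2)"
    by (simp only: times_divide_eq_right mult_ac)
  thus "Gamma (\<alpha> - \<tau> + 1) * (LBINT x:{0<..}. ?J x) = Gamma (\<alpha> + 1) * Gamma ((\<alpha> - \<tau> + 1) / 2) / 2"
    by (rule mult_left_cancel[OF G, THEN iffD1])
qed

lemma Gamma_three_halves: "Gamma (3/2 :: complex) = of_real (sqrt pi) / 2"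
proof -
  have "Gamma (1/2 + 1 :: complex) = 1/2 * Gamma (1/2)"
    by (rule Gamma_plus1) (rule complex_notin_nonpos_Ints, simp)
  thus ?thesis by (simp add: Gamma_one_half_complex)
qed

text \<open>The recurrence writes H through the degrees \<tau> - 1 and \<tau> - 2, which have
  negative real part because \<open>Re \<tau> < 1\<close>; \<open>Re \<tau> > -1\<close> gives
  convergence at 0.\<close>

lemma hermite_fun_mellin_diag:
  assumes \<tau>: "Re \<tau> > -1" "Re \<tau> < 1"
  shows "set_integrable lborel {0<..} (\<lambda>x. of_real x powr \<tau> * (hermite_fun \<tau> (of_real x) * exp (- (of_real x)\<^sup>2)))"
    and "(LBINT x:{0<..}. of_real x powr \<tau> * (hermite_fun \<tau> (of_real x) * exp (- (of_real x)\<^sup>2)))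
      = of_real (sqrt pi) / 2 * Gamma (\<tau> + 1)"
proof -
  let ?J = "\<lambda>\<alpha> \<tau> x. of_real x powr \<alpha> * (hermite_fun \<tau> (of_real x) * exp (- (of_real x)\<^sup>2))"
  have 1: "Re (\<tau> - 1) < 0" "Re (\<tau> + 1) > -1" and 2: "Re (\<tau> - 2) < 0" "Re \<tau> > -1" using \<tau> by simp_all
  have eq: "?J \<tau> \<tau> x = 2 * ?J (\<tau> + 1) (\<tau> - 1) x - 2 * (\<tau> - 1) * ?J \<tau> (\<tau> - 2) x" if "x \<in> {0<..}" for x
  proof -
    have "hermite_fun \<tau> (of_real x) = 2 * of_real x * hermite_fun (\<tau> - 1) (of_real x) -
        2 * (\<tau> - 1) * hermite_fun (\<tau> - 2) (of_real x)"
      using hermite_fun_plus1[of "\<tau> - 1" "of_real x"] by simp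
    moreover have "complex_of_real x powr (\<tau> + 1) = of_real x * of_real x powr \<tau>"
      using that by (simp add: powr_add)
    ultimately show ?thesis by (simp only:) (simp add: algebra_simps)
  qed
  have i: "set_integrable lborel {0<..} (\<lambda>x. 2 * ?J (\<tau> + 1) (\<tau> - 1) x)"
    "set_integrable lborel {0<..} (\<lambda>x. 2 * (\<tau> - 1) * ?J \<tau> (\<tau> - 2) x)"
    by (intro set_integrable_mult_right impI hermite_fun_mellin(1) 1 2)+
  have "set_integrable lborel {0<..} (\<lambda>x. 2 * ?J (\<tau> + 1) (\<tau> - 1) x - 2 * (\<tau> - 1) * ?J \<tau> (\<tau> - 2) x)"
    by (rule set_integral_diff(1)[OF i])
  also have "?this \<longleftrightarrow> set_integrable lborel {0<..} (?J \<tau> \<tau>)"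
    by (intro set_integrable_cong refl) (simp only: eq)
  finally show "set_integrable lborel {0<..} (?J \<tau> \<tau>)" .
  \<comment> \<open>In both terms exponent minus degree plus one equals 3, so both carry the factor
    Gamma(3/2) / (2 Gamma(3)) = sqrt(pi)/8.\<close>
  have G3: "Gamma (3 :: complex) = 2" using Gamma_fact[of 2, where 'a = complex] by (simp add: eval_nat_numeral)
  have A: "(LBINT x:{0<..}. ?J (\<tau> + 1) (\<tau> - 1) x) = Gamma (\<tau> + 1 + 1) * of_real (sqrt pi) / 8"
    using hermite_fun_mellin(2)[OF 1] by (simp add: G3 Gamma_three_halves mult.commute)
  have B: "(LBINT x:{0<..}. ?J \<tau> (\<tau> - 2) x) = Gamma (\<tau> + 1) * of_real (sqrt pi) / 8"
    using hermite_fun_mellin(2)[OF 2] by (simp add: G3 Gamma_three_halves mult.commute)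
  have "(LBINT x:{0<..}. ?J \<tau> \<tau> x) =
      (LBINT x:{0<..}. 2 * ?J (\<tau> + 1) (\<tau> - 1) x - 2 * (\<tau> - 1) * ?J \<tau> (\<tau> - 2) x)"
    by (intro set_lebesgue_integral_cong allI impI eq) simp_all
  also have "\<dots> = 2 * (LBINT x:{0<..}. ?J (\<tau> + 1) (\<tau> - 1) x) - 2 * (\<tau> - 1) * (LBINT x:{0<..}. ?J \<tau> (\<tau> - 2) x)"
    by (subst set_integral_diff(2)[OF i]) (simp only: set_integral_mult_right)
  also have "\<dots> = of_real (sqrt pi) / 2 * Gamma (\<tau> + 1)"
  proof -
    have "Gamma (\<tau> + 1 + 1) = (\<tau> + 1) * Gamma (\<tau> + 1)"
      by (rule Gamma_plus1) (rule complex_notin_nonpos_Ints, use \<tau> in simp)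
    thus ?thesis unfolding A B by (simp add: field_simps)
  qed
  finally show "(LBINT x:{0<..}. ?J \<tau> \<tau> x) = of_real (sqrt pi) / 2 * Gamma (\<tau> + 1)" .
qed

subsection \<open>The power on the slit plane and improper contour integrals\<close>

text \<open>Comparing coefficients gives (s + k) times the unknown coefficient equal to
  \<open>a k\<close>, solvable exactly because no s + k vanishes.\<close>

lemma power_series_ode_solution:
  fixes a :: "nat \<Rightarrow> complex"
  assumes a: "\<And>z. (\<lambda>k. a k * z ^ k) sums g z"
    and s: "\<And>k::nat. s + of_nat k \<noteq> 0"
  obtains P where "P holomorphic_on UNIV" "\<And>z. z * deriv P z + s * P z = g z"
proof -
  define c where "c = (\<lambda>k. a k / (s + of_nat k))"
  define P where "P = (\<lambda>z. \<Sum>k. c k * z ^ k)"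
  have sc: "summable (\<lambda>k. c k * z ^ k)" for z
  \<comment> \<open>From k >= |s| + 1 on, |s + k| is at least 1, so the new terms are dominated by
    the old ones. These converge absolutely at z because the series converges at the larger radius
    |z| + 1.\<close>
  proof (rule summable_comparison_test'[of "\<lambda>k. norm (a k * z ^ k)" "nat \<lceil>cmod s + 1\<rceil>"])
    have "cmod z < cmod (of_real (cmod z + 1) :: complex)" by (simp del: of_real_add)
    with sums_summable[OF a] show "summable (\<lambda>k. norm (a k * z ^ k))" by (rule powser_insidea)
    fix k assume "nat \<lceil>cmod s + 1\<rceil> \<le> k"
    hence "real k \<ge> cmod s + 1" by linarith
    moreover have "real k - cmod s \<le> cmod (s + of_nat k)"
      using norm_diff_ineq[of "of_nat k" s] by (simp add: add.commute)
    ultimately have "1 \<le> cmod (s + of_nat k)" by linarith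
    hence "cmod (a k) / cmod (s + of_nat k) \<le> cmod (a k) / 1" by (intro divide_left_mono) auto
    thus "norm (c k * z ^ k) \<le> norm (a k * z ^ k)"
      using mult_right_mono[of "cmod (a k) / cmod (s + of_nat k)" "cmod (a k)" "cmod (z ^ k)"]
      by (simp add: c_def norm_mult norm_divide)
  qed
  have der: "(P has_field_derivative (\<Sum>k. diffs c k * z ^ k)) (at z)" for z
    unfolding P_def by (rule termdiffs_strong_converges_everywhere) (rule sc)
  have ode: "z * deriv P z + s * P z = g z" for z
  proof -
    have "summable (\<lambda>k. diffs c k * z ^ k)"
      by (rule termdiff_converges_all) (rule sc)
    from diffs_equiv[OF this] have "(\<lambda>k. of_nat k * c k * z ^ (k - Suc 0)) sums deriv P z"
      using DERIV_imp_deriv[OF der[of z]] by simp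
    hence "(\<lambda>k. z * (of_nat k * c k * z ^ (k - Suc 0))) sums (z * deriv P z)" by (rule sums_mult)
    also have "(\<lambda>k. z * (of_nat k * c k * z ^ (k - Suc 0))) = (\<lambda>k. of_nat k * c k * z ^ k)"
    proof
      fix k show "z * (of_nat k * c k * z ^ (k - Suc 0)) = of_nat k * c k * z ^ k"
        by (cases k) (simp_all del: of_nat_Suc)
    qed
    finally have 1: "(\<lambda>k. of_nat k * c k * z ^ k) sums (z * deriv P z)" .
    have "(\<lambda>k. s * (c k * z ^ k)) sums (s * P z)"
      unfolding P_def by (intro sums_mult summable_sums sc)
    from sums_add[OF 1 this] have "(\<lambda>k. (s + of_nat k) * c k * z ^ k) sums (z * deriv P z + s * P z)"
      by (simp add: algebra_simps)
    also have "(\<lambda>k. (s + of_nat k) * c k * z ^ k) = (\<lambda>k. a k * z ^ k)"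
      using s by (simp add: c_def)
    finally show ?thesis using a sums_unique2 by blast
  qed
  have "P holomorphic_on UNIV"
    using der by (auto simp: holomorphic_on_open)
  thus thesis using ode that by blast
qed

lemma entire_ode_solution:
  assumes g: "g holomorphic_on UNIV" and s: "\<And>k::nat. s + of_nat k \<noteq> 0"
  obtains P where "P holomorphic_on UNIV" "\<And>z. z * deriv P z + s * P z = g z"
proof (rule power_series_ode_solution[of "\<lambda>n. (deriv ^^ n) g 0 / fact n" g s])
  fix z :: complex
  have "g holomorphic_on ball 0 (cmod z + 1)" using g by (rule holomorphic_on_subset) simp
  from holomorphic_power_series[OF this, of z] show "(\<lambda>n. (deriv ^^ n) g 0 / fact n * z ^ n) sums g z"
    by simp
qed (use s that in auto)

section \<open>The branch of the power with argument between 0 and 2 pi\<close>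

lemma nonneg_Reals_eq_image: "\<real>\<^sub>\<ge>\<^sub>0 = complex_of_real ` {0..}"
  by (auto simp: nonneg_Reals_def)

lemma minus_notin_nonpos_Reals: "z \<notin> \<real>\<^sub>\<ge>\<^sub>0 \<Longrightarrow> - z \<notin> \<real>\<^sub>\<le>\<^sub>0" for z :: complex
  by (auto simp: complex_nonpos_Reals_iff complex_nonneg_Reals_iff)

text \<open>The logarithm with argument in (0, 2 pi) is \<open>Ln (- z)\<close> + i pi: negating z
  moves the principal cut onto the half-line [0, \<infinity>), so analyticity off that half-line
  becomes visible.\<close>

lemma cpow_2pi_eq:
  assumes z: "z \<notin> \<real>\<^sub>\<ge>\<^sub>0"
  shows "cpow_2pi z s = exp (s * (Ln (- z) + \<i> * pi))"
proof -
  have nz: "z \<noteq> 0" using z by auto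
  have "Arg2pi z = Im (Ln (- z)) + pi" using z by (intro Arg2pi_Ln Arg2pi_gt_0)
  hence "complex_of_real (ln (cmod z)) + \<i> * complex_of_real (Arg2pi z) = Ln (- z) + \<i> * pi"
    using nz Re_Ln[of "- z"] by (simp add: complex_eq_iff)
  thus ?thesis by (simp add: cpow_2pi_def)
qed

lemma cpow_2pi_upper:
  assumes z: "Im z > 0"
  shows "cpow_2pi z s = z powr s"
proof -
  have "z \<notin> \<real>\<^sub>\<ge>\<^sub>0" "z \<noteq> 0" using z by (auto simp: complex_nonneg_Reals_iff)
  thus ?thesis using z by (simp add: cpow_2pi_eq Ln_minus powr_def)
qed

text \<open>The monodromy factor of the power around the origin. It is the only difference between
  the two ends of the contour and the source of exp(2 pi i \<tau>) - 1.\<close>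

lemma cpow_2pi_lower:
  assumes z: "Im z < 0"
  shows "cpow_2pi z s = exp (2 * complex_of_real pi * \<i> * s) * z powr s"
proof -
  have "z \<notin> \<real>\<^sub>\<ge>\<^sub>0" "z \<noteq> 0" using z by (auto simp: complex_nonneg_Reals_iff)
  thus ?thesis using z by (simp add: cpow_2pi_eq Ln_minus powr_def exp_add[symmetric] algebra_simps)
qed

lemma cpow_2pi_plus1:
  assumes z: "z \<notin> \<real>\<^sub>\<ge>\<^sub>0"
  shows "cpow_2pi z (s + 1) = z * cpow_2pi z s"
proof -
  have nz: "z \<noteq> 0" using z by auto
  have "exp (Ln (- z) + \<i> * pi) = z"
    using nz by (simp add: exp_add)
  thus ?thesis by (simp add: cpow_2pi_eq[OF z] distrib_right exp_add)
qed

lemma has_field_derivative_cpow_2pi: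
  assumes z: "z \<notin> \<real>\<^sub>\<ge>\<^sub>0"
  shows "((\<lambda>w. cpow_2pi w (s + 1)) has_field_derivative (s + 1) * cpow_2pi z s) (at z)"
proof (rule has_field_derivative_transform_within_open[where S = "- \<real>\<^sub>\<ge>\<^sub>0"])
  have nz: "z \<noteq> 0" using z by auto
  have e: "exp (Ln (- z) + \<i> * pi) = z" using nz by (simp add: exp_add)
  have "((\<lambda>w. exp ((s + 1) * (Ln (- w) + \<i> * pi))) has_field_derivative
      (exp ((s + 1) * (Ln (- z) + \<i> * pi)) * ((s + 1) * (1 / z)))) (at z)"
    using minus_notin_nonpos_Reals[OF z] nz by (auto intro!: derivative_eq_intros simp: field_simps)
  also have "exp ((s + 1) * (Ln (- z) + \<i> * pi)) * ((s + 1) * (1 / z)) = (s + 1) * cpow_2pi z s"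
    using nz by (simp add: cpow_2pi_eq[OF z] distrib_right exp_add[of "s * _"] e) (simp add: algebra_simps)
  finally show "((\<lambda>w. exp ((s + 1) * (Ln (- w) + \<i> * pi))) has_field_derivative (s + 1) * cpow_2pi z s) (at z)" .
qed (use z cpow_2pi_eq in auto)

section \<open>Improper contour integrals\<close>

lemma eventually_fst_less_snd: "\<forall>\<^sub>F p in at_bot \<times>\<^sub>F at_top. fst p < (snd p :: real)"
proof -
  have "\<forall>\<^sub>F p in at_bot \<times>\<^sub>F at_top. (fst p :: real) < 0 \<and> (snd p :: real) > 0"
    using eventually_prodI[OF eventually_gt_at_bot[of "0::real"] eventually_gt_at_top[of "0::real"]]
    by simp
  thus ?thesis by eventually_elim simp
qed

text \<open>The substitute for deforming the contour: by the fundamental theorem on each subpath,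
  only the limits of a primitive at the two ends matter.\<close>

lemma has_improper_contour_integral_primitive:
  assumes C: "hankel_contour C"
    and \<Phi>: "\<And>z. z \<notin> \<real>\<^sub>\<ge>\<^sub>0 \<Longrightarrow> (\<Phi> has_field_derivative f z) (at z)"
    and bot: "((\<lambda>t. \<Phi> (C t)) \<longlongrightarrow> K) at_bot"
    and top: "((\<lambda>t. \<Phi> (C t)) \<longlongrightarrow> L) at_top"
  shows "has_improper_contour_integral f (L - K) C"
proof -
  have *: "(f has_contour_integral (\<Phi> (C b) - \<Phi> (C a))) (subpath a b C)" if "a < b" for a b
  proof -
    have "(f has_contour_integral (\<Phi> (pathfinish (subpath a b C)) - \<Phi> (pathstart (subpath a b C)))) (subpath a b C)"
    proof (rule contour_integral_primitive)
      show "path_image (subpath a b C) \<subseteq> - \<real>\<^sub>\<ge>\<^sub>0"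
        using C by (auto simp: hankel_contour_def nonneg_Reals_eq_image path_image_def subpath_def)
      show "valid_path (subpath a b C)" using C that by (auto simp: hankel_contour_def)
    qed (use \<Phi> in \<open>auto intro: has_field_derivative_at_within\<close>)
    thus ?thesis by simp
  qed
  have ev: "\<forall>\<^sub>F p in at_bot \<times>\<^sub>F at_top.
      \<Phi> (C (snd p)) - \<Phi> (C (fst p)) = (\<lambda>(a, b). contour_integral (subpath a b C) f) p"
  proof -
    from eventually_fst_less_snd show ?thesis
    proof eventually_elim
      case (elim p)
      thus ?case using contour_integral_unique[OF *[of "fst p" "snd p"]] by (auto simp: case_prod_beta)
    qed
  qed
  have "((\<lambda>p. \<Phi> (C (snd p)) - \<Phi> (C (fst p))) \<longlongrightarrow> L - K) (at_bot \<times>\<^sub>F at_top)"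
    by (intro tendsto_diff filterlim_compose[OF top filterlim_snd] filterlim_compose[OF bot filterlim_fst])
  hence "((\<lambda>(a, b). contour_integral (subpath a b C) f) \<longlongrightarrow> L - K) (at_bot \<times>\<^sub>F at_top)"
    using ev by (rule Lim_transform_eventually)
  thus ?thesis using * by (auto simp: has_improper_contour_integral_def contour_integrable_on_def)
qed

lemma has_improper_contour_integral_unique:
  assumes "has_improper_contour_integral f I C" "has_improper_contour_integral f J C"
  shows "I = J"
  using assms unfolding has_improper_contour_integral_def
  by (intro tendsto_unique[of "at_bot \<times>\<^sub>F at_top :: (real \<times> real) filter"]) (auto simp: prod_filter_eq_bot)

lemma improper_contour_integral_unique:
  "has_improper_contour_integral f I C \<Longrightarrow> improper_contour_integral C f = I"
  unfolding improper_contour_integral_def by (blast intro: has_improper_contour_integral_unique)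

lemma has_improper_contour_integral_lmul_add:
  assumes f: "has_improper_contour_integral f I C" and g: "has_improper_contour_integral g J C"
  shows "has_improper_contour_integral (\<lambda>z. c * f z + g z) (c * I + J) C"
proof -
  have ab: "a < b \<Longrightarrow> (\<lambda>z. c * f z + g z) contour_integrable_on subpath a b C" for a b
    using f g by (auto simp: has_improper_contour_integral_def intro!: contour_integrable_add contour_integrable_lmul)
  from eventually_fst_less_snd have "\<forall>\<^sub>F p in at_bot \<times>\<^sub>F at_top.
      c * (\<lambda>(a, b). contour_integral (subpath a b C) f) p + (\<lambda>(a, b). contour_integral (subpath a b C) g) p
      = (\<lambda>(a, b). contour_integral (subpath a b C) (\<lambda>z. c * f z + g z)) p"
  proof eventually_elim
    case (elim p)
    thus ?case using f g
      by (simp add: case_prod_beta has_improper_contour_integral_def contour_integral_add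
          contour_integral_lmul contour_integrable_lmul)
  qed
  moreover have "((\<lambda>p. c * (\<lambda>(a, b). contour_integral (subpath a b C) f) p +
      (\<lambda>(a, b). contour_integral (subpath a b C) g) p) \<longlongrightarrow> c * I + J) (at_bot \<times>\<^sub>F at_top)"
    using f g unfolding has_improper_contour_integral_def by (intro tendsto_intros) auto
  ultimately show ?thesis
    using ab unfolding has_improper_contour_integral_def by (blast intro: Lim_transform_eventually)
qed

text \<open>The ends of the contour only approach the real axis, so a limit of the primitive along
  the axis is not enough. Integrating the exponentially small derivative gives a limit along the
  axis and controls the horizontal and the vertical distance separately; each costs one
  \<open>M * exp (- Re z)\<close>, hence the factor 2.\<close>

lemma half_strip_limit:
  fixes \<Psi> f :: "complex \<Rightarrow> complex"
  assumes der: "\<And>z. Re z \<ge> 1 \<Longrightarrow> \<bar>Im z\<bar> \<le> 1 \<Longrightarrow> (\<Psi> has_field_derivative f z) (at z)"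
    and bound: "\<And>z. Re z \<ge> 1 \<Longrightarrow> \<bar>Im z\<bar> \<le> 1 \<Longrightarrow> cmod (f z) \<le> M * exp (- Re z)"
  obtains L where "\<And>z. Re z \<ge> 1 \<Longrightarrow> \<bar>Im z\<bar> \<le> 1 \<Longrightarrow> cmod (\<Psi> z - L) \<le> 2 * M * exp (- Re z)"
proof -
  have "0 \<le> cmod (f 1)" by simp
  also have "\<dots> \<le> M * exp (- 1)" using bound[of 1] by simp
  finally have M: "M \<ge> 0" by (simp add: zero_le_mult_iff)
  have horiz: "cmod (\<Psi> (of_real y) - \<Psi> (of_real x)) \<le> M * exp (- x)" if xy: "1 \<le> x" "x \<le> y" for x y :: real
  proof (cases "x = y")
    case False
    hence "x < y" using xy by simp
    have "norm (\<Psi> (of_real y) - \<Psi> (of_real x)) \<le> (- M * exp (- y)) - (- M * exp (- x))"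
    \<comment> \<open>The comparison function -M exp(-t) has the derivative that bounds
      \<open>f\<close> on the axis.\<close>
    proof (rule differentiable_bound_general[where f' = "\<lambda>t. f (of_real t)" and \<phi>' = "\<lambda>t. M * exp (- t)"])
      have d: "((\<lambda>t. \<Psi> (of_real t)) has_vector_derivative f (of_real t)) (at t)" if "x \<le> t" for t
        using der[of "of_real t"] that xy by (intro has_vector_derivative_real_field) auto
      thus "\<And>t. x < t \<Longrightarrow> t < y \<Longrightarrow> ((\<lambda>t. \<Psi> (of_real t)) has_vector_derivative f (of_real t)) (at t)" by simp
      show "continuous_on {x..y} (\<lambda>t. \<Psi> (of_real t))"
        by (intro continuous_at_imp_continuous_on ballI has_vector_derivative_continuous[OF d]) auto
      show "continuous_on {x..y} (\<lambda>y. - M * exp (- y))" by (intro continuous_intros)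
      show "\<And>t. ((\<lambda>y. - M * exp (- y)) has_vector_derivative M * exp (- t)) (at t)"
        unfolding has_real_derivative_iff_has_vector_derivative[symmetric]
        by (auto intro!: derivative_eq_intros)
      show "\<And>t. x < t \<Longrightarrow> t < y \<Longrightarrow> norm (f (of_real t)) \<le> M * exp (- t)"
        using bound[of "of_real t" for t] xy by simp
    qed fact
    also have "\<dots> \<le> M * exp (- x)" using M by simp
    finally show ?thesis .
  qed (use M in simp)
  have expn: "(\<lambda>n::nat. M * exp (- real n)) \<longlonglongrightarrow> 0" by real_asymp
  have "Cauchy (\<lambda>n. \<Psi> (of_real (real n)))"
  proof (rule metric_CauchyI)
    fix e :: real assume e: "e > 0"
    from order_tendstoD(2)[OF expn e] obtain N0 where N0: "\<And>n. n \<ge> N0 \<Longrightarrow> M * exp (- real n) < e"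
      by (auto simp: eventually_at_top_linorder)
    define N where "N = max 1 N0"
    have *: "dist (\<Psi> (of_real (real m))) (\<Psi> (of_real (real n))) < e" if "N \<le> n" "n \<le> m" for m n
      using horiz[of "real n" "real m"] N0[of n] that by (simp add: N_def dist_norm)
    show "\<exists>N. \<forall>m\<ge>N. \<forall>n\<ge>N. dist (\<Psi> (of_real (real m))) (\<Psi> (of_real (real n))) < e"
      using * by (metis dist_commute nle_le)
  qed
  then obtain L where L: "(\<lambda>n. \<Psi> (of_real (real n))) \<longlonglongrightarrow> L" by (auto simp: Cauchy_convergent_iff convergent_def)
  have "cmod (\<Psi> z - L) \<le> 2 * M * exp (- Re z)" if z: "Re z \<ge> 1" "\<bar>Im z\<bar> \<le> 1" for z
  proof -
    have "cmod (L - \<Psi> (of_real (Re z))) \<le> M * exp (- Re z)"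
    proof (rule Lim_norm_ubound[of sequentially])
      show "(\<lambda>n. \<Psi> (of_real (real n)) - \<Psi> (of_real (Re z))) \<longlonglongrightarrow> L - \<Psi> (of_real (Re z))"
        by (intro tendsto_intros L)
      show "\<forall>\<^sub>F n in sequentially. norm (\<Psi> (of_real (real n)) - \<Psi> (of_real (Re z))) \<le> M * exp (- Re z)"
        using eventually_ge_at_top[of "nat \<lceil>Re z\<rceil>"]
      proof eventually_elim
        case (elim n)
        thus ?case by (intro horiz) (use z in linarith)+
      qed
    qed simp
    moreover have "cmod (\<Psi> z - \<Psi> (of_real (Re z))) \<le> M * exp (- Re z) * cmod (z - of_real (Re z))"
    proof (rule field_differentiable_bound[of "closed_segment (of_real (Re z)) z"])
      fix w assume "w \<in> closed_segment (of_real (Re z)) z"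
      then obtain u where u: "0 \<le> u" "u \<le> 1" "w = (1 - u) *\<^sub>R of_real (Re z) + u *\<^sub>R z"
        by (auto simp: closed_segment_def)
      have "Re w = (1 - u) * Re z + u * Re z" unfolding u(3) by simp
      moreover have "\<bar>Im w\<bar> = u * \<bar>Im z\<bar>" unfolding u(3) using u(1) by (simp add: abs_mult)
      ultimately have w: "Re w = Re z" "\<bar>Im w\<bar> \<le> 1"
        using u(1,2) z mult_le_one[of u "\<bar>Im z\<bar>"] by (simp_all add: algebra_simps)
      show "(\<Psi> has_field_derivative f w) (at w within closed_segment (of_real (Re z)) z)"
        using der[of w] w z by (auto intro: has_field_derivative_at_within)
      show "cmod (f w) \<le> M * exp (- Re z)" using bound[of w] w z by simp
    qed auto
    moreover have "M * exp (- Re z) * cmod (z - of_real (Re z)) \<le> M * exp (- Re z)"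
    proof -
      have "z - of_real (Re z) = \<i> * of_real (Im z)" by (simp add: complex_eq_iff)
      hence "cmod (z - of_real (Re z)) \<le> 1" using z by (simp add: norm_mult)
      thus ?thesis using M mult_left_mono[of "cmod (z - of_real (Re z))" 1 "M * exp (- Re z)"] by simp
    qed
    moreover have "cmod (\<Psi> z - L) \<le> cmod (\<Psi> z - \<Psi> (of_real (Re z))) + cmod (L - \<Psi> (of_real (Re z)))"
      using norm_triangle_ineq4[of "\<Psi> z - \<Psi> (of_real (Re z))" "L - \<Psi> (of_real (Re z))"] by simp
    ultimately show ?thesis by linarith
  qed
  thus thesis using that by blast
qed

text \<open>In the half-strip the Hermite function and the power grow at most polynomially, while
  the Gaussian is at most a constant times exp(-2 \<open>Re z\<close>). Half of that exponential
  absorbs the polynomial.\<close>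

lemma hermite_weighted_decay:
  "\<exists>M. \<forall>z. Re z \<ge> 1 \<and> \<bar>Im z\<bar> \<le> 1 \<longrightarrow>
     cmod (z powr s * (hermite_fun \<tau> z * exp (- z\<^sup>2))) \<le> M * exp (- Re z)"
proof -
  obtain A n where A: "A \<ge> 0" "\<And>z. Re z \<ge> 0 \<Longrightarrow> cmod (hermite_fun \<tau> z) \<le> A * (1 + cmod z) ^ n"
    using hermite_fun_poly_bound by blast
  define m where "m = nat \<lceil>\<bar>Re s\<bar>\<rceil>"
  \<comment> \<open>The first factor bounds the contribution of the argument of z to
    \<open>z powr s\<close>. The factorial comes from comparing (2 + x)^(m + n) with one term of the
    series of exp(2 + x), and exp 4 from exp(2 - 2x) exp(2 + x) = exp 4 exp(-x).\<close>
  define M where "M = exp (\<bar>Im s\<bar> * pi) * A * fact (m + n) * exp 4"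
  have "cmod (z powr s * (hermite_fun \<tau> z * exp (- z\<^sup>2))) \<le> M * exp (- Re z)"
    if z: "Re z \<ge> 1" "\<bar>Im z\<bar> \<le> 1" for z
  proof -
    define x where "x = Re z"
    have nz: "z \<noteq> 0" using z by auto
    have z1: "1 \<le> cmod z" using z complex_Re_le_cmod[of z] by linarith
    have zx: "1 + cmod z \<le> 2 + x" using cmod_le[of z] z by (simp add: x_def)
    have p: "cmod (z powr s) \<le> exp (\<bar>Im s\<bar> * pi) * (2 + x) ^ m"
    proof -
      have "cmod (z powr s) = exp (Re s * ln (cmod z)) * exp (- (Im s * Im (Ln z)))"
        using nz by (simp add: powr_def exp_diff exp_minus divide_inverse)
      also have "\<dots> \<le> (1 + cmod z) ^ m * exp (\<bar>Im s\<bar> * pi)"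
      proof (rule mult_mono)
        have "Re s * ln (cmod z) \<le> real m * ln (1 + cmod z)"
        proof -
          have "Re s * ln (cmod z) \<le> real m * ln (cmod z)"
            using z1 by (intro mult_right_mono) (auto simp: m_def, linarith)
          also have "\<dots> \<le> real m * ln (1 + cmod z)"
            using z1 by (intro mult_left_mono ln_mono) linarith+
          finally show ?thesis .
        qed
        hence "exp (Re s * ln (cmod z)) \<le> exp (real m * ln (1 + cmod z))" by simp
        also have "\<dots> = (1 + cmod z) ^ m" using z1 by (simp add: exp_of_nat_mult)
        finally show "exp (Re s * ln (cmod z)) \<le> (1 + cmod z) ^ m" .
        have "\<bar>Im s * Im (Ln z)\<bar> \<le> \<bar>Im s\<bar> * pi"
          unfolding abs_mult using Im_Ln_le_pi[OF nz] mpi_less_Im_Ln[OF nz] by (intro mult_left_mono) auto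
        thus "exp (- (Im s * Im (Ln z))) \<le> exp (\<bar>Im s\<bar> * pi)" by auto
      qed auto
      also have "\<dots> \<le> (2 + x) ^ m * exp (\<bar>Im s\<bar> * pi)"
        using zx by (intro mult_right_mono power_mono) auto
      finally show ?thesis by (simp add: mult.commute)
    qed
    have h: "cmod (hermite_fun \<tau> z) \<le> A * (2 + x) ^ n"
      by (rule order.trans[OF A(2)]) (use z zx A(1) in \<open>auto intro!: mult_left_mono power_mono\<close>)
    \<comment> \<open>The modulus is exp(y^2 - x^2) with y = \<open>Im z\<close>; here y^2 <= 1, and
      x^2 >= 2x - 1 since (x - 1)^2 is nonnegative.\<close>
    have e: "cmod (exp (- z\<^sup>2)) \<le> exp (2 - 2 * x)"
    proof -
      have "(Im z)\<^sup>2 \<le> 1" using z by (simp add: abs_square_le_1)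
      moreover have "0 \<le> (x - 1)\<^sup>2" by simp
      ultimately have "- ((Re z)\<^sup>2 - (Im z)\<^sup>2) \<le> 2 - 2 * x"
        unfolding x_def power2_diff by simp
      thus ?thesis by (simp add: Re_power2)
    qed
    have x: "x \<ge> 1" using z by (simp add: x_def)
    have pe: "(2 + x) ^ (m + n) \<le> fact (m + n) * exp (2 + x)"
    proof -
      have "(2 + x) ^ (m + n) / fact (m + n) \<le> exp (2 + x)"
      proof -
        have "(\<Sum>i\<in>{m + n}. (2 + x) ^ i /\<^sub>R fact i) \<le> exp (2 + x)"
          unfolding exp_def by (rule sum_le_suminf) (use x in \<open>auto intro: summable_exp\<close>)
        thus ?thesis by (simp add: divide_inverse mult.commute)
      qed
      thus ?thesis by (simp add: field_simps)
    qed
    have "cmod (z powr s * (hermite_fun \<tau> z * exp (- z\<^sup>2)))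
       \<le> (exp (\<bar>Im s\<bar> * pi) * (2 + x) ^ m) * ((A * (2 + x) ^ n) * exp (2 - 2 * x))"
      unfolding norm_mult using p h e A(1) x by (intro mult_mono) auto
    also have "\<dots> = exp (\<bar>Im s\<bar> * pi) * A * exp (2 - 2 * x) * (2 + x) ^ (m + n)"
      by (simp add: power_add)
    also have "\<dots> \<le> exp (\<bar>Im s\<bar> * pi) * A * exp (2 - 2 * x) * (fact (m + n) * exp (2 + x))"
      using pe A(1) by (intro mult_left_mono) auto
    also have "\<dots> = exp (\<bar>Im s\<bar> * pi) * A * fact (m + n) * (exp (2 - 2 * x) * exp (2 + x))" by simp
    also have "exp (2 - 2 * x) * exp (2 + x) = exp 4 * exp (- x)" by (simp flip: exp_add)
    finally show ?thesis by (simp add: M_def x_def)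
  qed
  thus ?thesis by blast
qed

subsection \<open>The contour integral\<close>

lemma hankel_contour_at_bot:
  assumes "hankel_contour C"
  shows "\<forall>\<^sub>F t in at_bot. Re (C t) \<ge> 1 \<and> \<bar>Im (C t)\<bar> \<le> 1 \<and> Im (C t) > 0"
proof -
  have "filterlim (\<lambda>t. Re (C t)) at_top at_bot" "((\<lambda>t. Im (C t)) \<longlongrightarrow> 0) at_bot"
    "\<forall>\<^sub>F t in at_bot. Im (C t) > 0" using assms by (auto simp: hankel_contour_def)
  moreover have "\<forall>\<^sub>F t in at_bot. Re (C t) \<ge> 1"
    using calculation(1) by (auto simp: filterlim_at_top)
  moreover have "\<forall>\<^sub>F t in at_bot. dist (Im (C t)) 0 < 1"
    using calculation(2) by (rule tendstoD) simp
  ultimately show ?thesis by (auto simp: dist_norm elim: eventually_elim2 intro: eventually_conj)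
qed

lemma hankel_contour_at_top:
  assumes "hankel_contour C"
  shows "\<forall>\<^sub>F t in at_top. Re (C t) \<ge> 1 \<and> \<bar>Im (C t)\<bar> \<le> 1 \<and> Im (C t) < 0"
proof -
  have "filterlim (\<lambda>t. Re (C t)) at_top at_top" "((\<lambda>t. Im (C t)) \<longlongrightarrow> 0) at_top"
    "\<forall>\<^sub>F t in at_top. Im (C t) < 0" using assms by (auto simp: hankel_contour_def)
  moreover have "\<forall>\<^sub>F t in at_top. Re (C t) \<ge> 1"
    using calculation(1) by (auto simp: filterlim_at_top)
  moreover have "\<forall>\<^sub>F t in at_top. dist (Im (C t)) 0 < 1"
    using calculation(2) by (rule tendstoD) simp
  ultimately show ?thesis by (auto simp: dist_norm elim: eventually_elim2 intro: eventually_conj)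
qed

lemma hankel_contour_cpow_limits:
  assumes C: "hankel_contour C"
    and bound: "\<And>z. Re z \<ge> 1 \<Longrightarrow> \<bar>Im z\<bar> \<le> 1 \<Longrightarrow> cmod (z powr s * P z - L) \<le> M * exp (- Re z)"
  shows "((\<lambda>t. cpow_2pi (C t) s * P (C t)) \<longlongrightarrow> L) at_bot"
    and "((\<lambda>t. cpow_2pi (C t) s * P (C t)) \<longlongrightarrow> exp (2 * complex_of_real pi * \<i> * s) * L) at_top"
proof -
  \<comment> \<open>\<open>Q\<close> absorbs the sign condition on \<open>Im (C t)\<close>, so that
    one argument with the principal power serves both ends.\<close>
  have lim: "((\<lambda>t. C t powr s * P (C t)) \<longlongrightarrow> L) F"
    if "filterlim (\<lambda>t. Re (C t)) at_top F" "\<forall>\<^sub>F t in F. Re (C t) \<ge> 1 \<and> \<bar>Im (C t)\<bar> \<le> 1 \<and> Q t" for F and Q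
  proof (rule Lim_null[THEN iffD2], rule Lim_null_comparison)
    show "\<forall>\<^sub>F t in F. norm (C t powr s * P (C t) - L) \<le> M * exp (- Re (C t))"
      using that(2) by eventually_elim (use bound in blast)
    have "((\<lambda>x. M * exp (- x)) \<longlongrightarrow> 0) (at_top :: real filter)" by real_asymp
    from filterlim_compose[OF this that(1)] show "((\<lambda>t. M * exp (- Re (C t))) \<longlongrightarrow> 0) F" .
  qed
  show "((\<lambda>t. cpow_2pi (C t) s * P (C t)) \<longlongrightarrow> L) at_bot"
  proof (rule Lim_transform_eventually)
    show "((\<lambda>t. C t powr s * P (C t)) \<longlongrightarrow> L) at_bot"
      using C hankel_contour_at_bot[OF C] by (intro lim) (auto simp: hankel_contour_def)
    show "\<forall>\<^sub>F t in at_bot. C t powr s * P (C t) = cpow_2pi (C t) s * P (C t)"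
      using hankel_contour_at_bot[OF C] by eventually_elim (simp add: cpow_2pi_upper)
  qed
  show "((\<lambda>t. cpow_2pi (C t) s * P (C t)) \<longlongrightarrow> exp (2 * complex_of_real pi * \<i> * s) * L) at_top"
  proof (rule Lim_transform_eventually)
    show "((\<lambda>t. exp (2 * complex_of_real pi * \<i> * s) * (C t powr s * P (C t))) \<longlongrightarrow>
        exp (2 * complex_of_real pi * \<i> * s) * L) at_top"
      using C hankel_contour_at_top[OF C] by (intro tendsto_mult_left lim) (auto simp: hankel_contour_def)
    show "\<forall>\<^sub>F t in at_top. exp (2 * complex_of_real pi * \<i> * s) * (C t powr s * P (C t)) = cpow_2pi (C t) s * P (C t)"
      using hankel_contour_at_top[OF C] by eventually_elim (simp add: cpow_2pi_lower)
  qed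
qed

definition hankel_integrand :: "complex \<Rightarrow> complex \<Rightarrow> complex" where
  "hankel_integrand \<tau> = (\<lambda>\<zeta>. cpow_2pi \<zeta> \<tau> * hermite_fun \<tau> \<zeta> * exp (- \<zeta>\<^sup>2))"

lemma exp_2pi_i_plus1:
  "exp (2 * complex_of_real pi * \<i> * (s + 1)) = exp (2 * complex_of_real pi * \<i> * s)"
  by (simp add: distrib_left exp_add)

text \<open>The product rule gives z to the power s times z P' + (s + 1) P; the differential
  equation was chosen to make the second factor \<open>g z\<close>.\<close>

lemma has_field_derivative_powr_times_solution:
  fixes g P :: "complex \<Rightarrow> complex"
  assumes P: "P holomorphic_on UNIV" and ode: "z * deriv P z + (s + 1) * P z = g z"
    and z: "z \<notin> \<real>\<^sub>\<le>\<^sub>0"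
  shows "((\<lambda>z. z powr (s + 1) * P z) has_field_derivative z powr s * g z) (at z)"
proof -
  have "z \<noteq> 0" using z by auto
  have "(P has_field_derivative deriv P z) (at z)"
    by (rule holomorphic_derivI[OF P]) auto
  from DERIV_mult[OF has_field_derivative_powr[OF z, of "s + 1"] this] show ?thesis
    using \<open>z \<noteq> 0\<close> by (simp add: powr_add ode[symmetric] algebra_simps)
qed

text \<open>Fundamental theorem on (0, \<infinity>). The primitive has modulus x to the power
  \<open>Re s + 1\<close> times |P(x)|, which vanishes at 0 because \<open>Re s > -1\<close>, so
  only the limit at infinity remains.\<close>

lemma improper_integral_tail_value:
  fixes g P :: "complex \<Rightarrow> complex"
  assumes s: "Re s > -1"
    and P: "P holomorphic_on UNIV" and g: "g holomorphic_on UNIV"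
    and ode: "\<And>z. z * deriv P z + (s + 1) * P z = g z"
    and int: "set_integrable lborel {0<..} (\<lambda>x. of_real x powr s * g (of_real x))"
    and L: "((\<lambda>x. of_real x powr (s + 1) * P (of_real x)) \<longlongrightarrow> L) at_top"
  shows "(LBINT x:{0<..}. of_real x powr s * g (of_real x)) = L"
proof -
  let ?\<Psi> = "\<lambda>x::real. of_real x powr (s + 1) * P (of_real x)"
  let ?f = "\<lambda>x::real. of_real x powr s * g (of_real x)"
  have contP: "isCont P z" for z
    using holomorphic_on_imp_continuous_on[OF P] by (simp add: continuous_on_eq_continuous_at)
  have contg: "isCont g z" for z
    using holomorphic_on_imp_continuous_on[OF g] by (simp add: continuous_on_eq_continuous_at)
  have "(LBINT x=0..\<infinity>. ?f x) = L - 0"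
  proof (rule interval_integral_FTC_integrable)
    fix x :: real assume "0 < ereal x" "ereal x < \<infinity>"
    hence x: "x > 0" by simp
    have "((\<lambda>z. z powr (s + 1) * P z) has_field_derivative of_real x powr s * g (of_real x)) (at (of_real x))"
      using x by (intro has_field_derivative_powr_times_solution[OF P ode]) (auto simp: complex_nonpos_Reals_iff)
    thus "(?\<Psi> has_vector_derivative ?f x) (at x)"
      by (rule has_vector_derivative_real_field)
    show "isCont ?f x"
      using x by (intro continuous_intros continuous_at_compose[of _ "of_real" g, unfolded o_def] contg) auto
  next
    show "set_integrable lborel (einterval 0 \<infinity>) ?f" using int by (simp add: zero_ereal_def einterval_eq)
    have "((\<lambda>x::real. x powr (Re s + 1) * cmod (P (of_real x))) \<longlongrightarrow> 0 * cmod (P (of_real 0))) (at_right 0)"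
    proof (intro tendsto_mult tendsto_norm)
      show "((\<lambda>x::real. x powr (Re s + 1)) \<longlongrightarrow> 0) (at_right 0)"
        using s by real_asymp
      have "isCont (\<lambda>x. P (complex_of_real x)) 0"
        by (rule continuous_at_compose[of _ "of_real" P, unfolded o_def]) (use contP in auto)
      thus "((\<lambda>x. P (complex_of_real x)) \<longlongrightarrow> P (of_real 0)) (at_right 0)"
        by (auto simp: isCont_def intro: filterlim_mono[OF _ order_refl at_le])
    qed
    moreover have "\<forall>\<^sub>F x::real in at_right 0. x powr (Re s + 1) * cmod (P (of_real x)) = norm (?\<Psi> x)"
      using eventually_at_right_less[of 0] by eventually_elim (simp add: norm_mult norm_powr_of_real)
    ultimately have "((\<lambda>x. norm (?\<Psi> x)) \<longlongrightarrow> 0) (at_right 0)"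
      by (auto intro: Lim_transform_eventually)
    hence "(?\<Psi> \<longlongrightarrow> 0) (at_right 0)" by (rule tendsto_norm_zero_cancel)
    thus "((?\<Psi> \<circ> real_of_ereal) \<longlongrightarrow> 0) (at_right 0)"
      by (simp add: zero_ereal_def ereal_tendsto_simps)
    show "((?\<Psi> \<circ> real_of_ereal) \<longlongrightarrow> L) (at_left \<infinity>)"
      using L by (simp add: ereal_tendsto_simps)
  qed simp
  thus ?thesis by (simp add: interval_integral_to_infinity_eq zero_ereal_def)
qed

text \<open>The primitive tends to \<open>L\<close> above the axis and to exp(2 pi i (\<tau> + 1))
  \<open>L\<close> below it, and the added 1 does not change the exponential. The integral thus
  exists for every admissible \<tau>; \<open>L\<close> is evaluated only in the strip where the
  Mellin integral is known.\<close>

lemma hankel_integrand_integral: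
  assumes C: "hankel_contour C" and \<tau>: "\<And>k::nat. \<tau> + 1 + of_nat k \<noteq> 0"
  obtains L where "has_improper_contour_integral (hankel_integrand \<tau>)
        ((exp (2 * complex_of_real pi * \<i> * \<tau>) - 1) * L) C"
    and "Re \<tau> > -1 \<Longrightarrow> Re \<tau> < 1 \<Longrightarrow> L = of_real (sqrt pi) / 2 * Gamma (\<tau> + 1)"
proof -
  define g where "g = (\<lambda>z. hermite_fun \<tau> z * exp (- z\<^sup>2))"
  have g: "g holomorphic_on UNIV" unfolding g_def by (intro holomorphic_intros)
  obtain P where P: "P holomorphic_on UNIV" and ode: "\<And>z. z * deriv P z + (\<tau> + 1) * P z = g z"
    using entire_ode_solution[OF g \<tau>] by blast
  have P': "(P has_field_derivative deriv P z) (at z)" for z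
    by (rule holomorphic_derivI[OF P]) auto
  obtain M where M: "\<And>z. Re z \<ge> 1 \<Longrightarrow> \<bar>Im z\<bar> \<le> 1 \<Longrightarrow> cmod (z powr \<tau> * g z) \<le> M * exp (- Re z)"
    using hermite_weighted_decay[of \<tau> \<tau>] unfolding g_def by blast
  have d\<Psi>: "((\<lambda>z. z powr (\<tau> + 1) * P z) has_field_derivative z powr \<tau> * g z) (at z)" if "Re z \<ge> 1" for z
    using that by (intro has_field_derivative_powr_times_solution[OF P ode]) (auto simp: complex_nonpos_Reals_iff)
  obtain L where L: "\<And>z. Re z \<ge> 1 \<Longrightarrow> \<bar>Im z\<bar> \<le> 1 \<Longrightarrow>
      cmod (z powr (\<tau> + 1) * P z - L) \<le> 2 * M * exp (- Re z)"
    using half_strip_limit[OF d\<Psi> M] by blast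
  have d\<Phi>: "((\<lambda>z. cpow_2pi z (\<tau> + 1) * P z) has_field_derivative hankel_integrand \<tau> z) (at z)"
    if z: "z \<notin> \<real>\<^sub>\<ge>\<^sub>0" for z
  proof -
    have "((\<lambda>z. cpow_2pi z (\<tau> + 1) * P z) has_field_derivative
        (\<tau> + 1) * cpow_2pi z \<tau> * P z + deriv P z * cpow_2pi z (\<tau> + 1)) (at z)"
      by (rule DERIV_mult[OF has_field_derivative_cpow_2pi[OF z] P'])
    also have "(\<tau> + 1) * cpow_2pi z \<tau> * P z + deriv P z * cpow_2pi z (\<tau> + 1) =
        cpow_2pi z \<tau> * (z * deriv P z + (\<tau> + 1) * P z)"
      unfolding cpow_2pi_plus1[OF z] by (simp add: algebra_simps)
    also have "\<dots> = hankel_integrand \<tau> z"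
      by (simp add: ode) (simp add: g_def hankel_integrand_def)
    finally show ?thesis .
  qed
  have "has_improper_contour_integral (hankel_integrand \<tau>)
      (exp (2 * complex_of_real pi * \<i> * (\<tau> + 1)) * L - L) C"
    by (rule has_improper_contour_integral_primitive[OF C d\<Phi>])
       (rule hankel_contour_cpow_limits[OF C] L | assumption)+
  hence "has_improper_contour_integral (hankel_integrand \<tau>)
      ((exp (2 * complex_of_real pi * \<i> * \<tau>) - 1) * L) C"
    by (simp only: exp_2pi_i_plus1 left_diff_distrib mult_1_left)
  moreover have "L = of_real (sqrt pi) / 2 * Gamma (\<tau> + 1)" if "Re \<tau> > -1" "Re \<tau> < 1"
  proof -
    have "((\<lambda>x. of_real x powr (\<tau> + 1) * P (of_real x) - L) \<longlongrightarrow> 0) at_top"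
    proof (rule Lim_null_comparison)
      show "\<forall>\<^sub>F x in at_top. norm (of_real x powr (\<tau> + 1) * P (of_real x) - L) \<le> 2 * M * exp (- x)"
        using eventually_ge_at_top[of "1::real"]
      proof eventually_elim
        case (elim x)
        thus ?case using L[of "of_real x"] by simp
      qed
      show "((\<lambda>x. 2 * M * exp (- x)) \<longlongrightarrow> 0) at_top" by real_asymp
    qed
    hence "((\<lambda>x. of_real x powr (\<tau> + 1) * P (of_real x)) \<longlongrightarrow> L) at_top"
      by (rule Lim_null[THEN iffD2])
    from improper_integral_tail_value[OF that(1) P g ode _ this] hermite_fun_mellin_diag[OF that]
    show ?thesis by (simp add: g_def)
  qed
  ultimately show thesis using that by blast
qed

text \<open>Integration by parts: the difference \<open>h\<close> has a primitive that decays at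
  both ends, so its integral is 0 and no boundary terms survive.\<close>

lemma hankel_integrand_plus1:
  assumes C: "hankel_contour C" and I: "has_improper_contour_integral (hankel_integrand \<tau>) I C"
  shows "has_improper_contour_integral (hankel_integrand (\<tau> + 1)) ((\<tau> + 1) * I) C"
proof -
  define g where "g = (\<lambda>z. hermite_fun \<tau> z * exp (- z\<^sup>2))"
  define h where "h = (\<lambda>z. hankel_integrand (\<tau> + 1) z - (\<tau> + 1) * hankel_integrand \<tau> z)"
  have d: "((\<lambda>z. cpow_2pi z (\<tau> + 1) * - g z) has_field_derivative h z) (at z)" if z: "z \<notin> \<real>\<^sub>\<ge>\<^sub>0" for z
  proof -
    have "(g has_field_derivative - (hermite_fun (\<tau> + 1) z * exp (- z\<^sup>2))) (at z)"
      unfolding g_def by (rule has_field_derivative_hermite_weighted)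
    from DERIV_mult[OF has_field_derivative_cpow_2pi[OF z, of \<tau>] DERIV_minus[OF this]]
    show ?thesis by (simp add: h_def g_def hankel_integrand_def algebra_simps)
  qed
  obtain M where M: "\<And>z. Re z \<ge> 1 \<Longrightarrow> \<bar>Im z\<bar> \<le> 1 \<Longrightarrow> cmod (z powr (\<tau> + 1) * g z) \<le> M * exp (- Re z)"
    using hermite_weighted_decay[of "\<tau> + 1" \<tau>] unfolding g_def by blast
  hence "\<And>z. Re z \<ge> 1 \<Longrightarrow> \<bar>Im z\<bar> \<le> 1 \<Longrightarrow> cmod (z powr (\<tau> + 1) * - g z - 0) \<le> M * exp (- Re z)"
    by simp
  from has_improper_contour_integral_primitive[OF C d hankel_contour_cpow_limits[OF C this]]
  have "has_improper_contour_integral h 0 C" by simp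
  from has_improper_contour_integral_lmul_add[OF I this, of "\<tau> + 1"] show ?thesis
    by (simp add: h_def)
qed

text \<open>Subtracting the floor of \<open>Re \<tau>\<close> moves the degree into 0 <= Re < 1,
  where the value is known, and the functional equation carries it back by an integer in either
  direction. Degrees that are not integers stay clear of all poles on the way.\<close>

lemma hankel_integrand_Gamma:
  assumes C: "hankel_contour C" and \<tau>: "\<tau> \<notin> \<int>"
  shows "has_improper_contour_integral (hankel_integrand \<tau>)
      ((exp (2 * complex_of_real pi * \<i> * \<tau>) - 1) * (of_real (sqrt pi) / 2 * Gamma (\<tau> + 1))) C"
proof -
  define V where "V = (\<lambda>\<tau>. (exp (2 * complex_of_real pi * \<i> * \<tau>) - 1) * (of_real (sqrt pi) / 2 * Gamma (\<tau> + 1)))"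
  define \<tau>0 where "\<tau>0 = \<tau> - of_int \<lfloor>Re \<tau>\<rfloor>"
  have nonint: "\<tau>0 + of_int i \<notin> \<int>" for i
  proof
    assume "\<tau>0 + of_int i \<in> \<int>"
    hence "(\<tau>0 + of_int i) + of_int (\<lfloor>Re \<tau>\<rfloor> - i) \<in> \<int>" by (rule Ints_add) (rule Ints_of_int)
    thus False using \<tau> by (simp add: \<tau>0_def)
  qed
  have not_pole: "\<tau>0 + of_int i + 1 + of_nat k \<noteq> 0" for i and k :: nat
  proof
    assume "\<tau>0 + of_int i + 1 + of_nat k = 0"
    hence "\<tau>0 + of_int i = - (1 + of_nat k)" by (simp add: add_eq_0_iff2 add.assoc)
    moreover have "- (1 + of_nat k) \<in> (\<int> :: complex set)" by (intro Ints_minus Ints_add Ints_1 Ints_of_nat)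
    ultimately show False using nonint[of i] by simp
  qed
  \<comment> \<open>The exponential prefactor has period 1, so \<open>V\<close> inherits the
    functional equation of Gamma.\<close>
  have V_Suc: "V (\<tau>0 + of_int i + 1) = (\<tau>0 + of_int i + 1) * V (\<tau>0 + of_int i)" for i
  proof -
    have "\<tau>0 + of_int i + 1 \<notin> \<int>\<^sub>\<le>\<^sub>0"
      using nonint[of "i + 1"] nonpos_Ints_subset_Ints by (auto simp: add.assoc)
    hence "Gamma (\<tau>0 + of_int i + 1 + 1) = (\<tau>0 + of_int i + 1) * Gamma (\<tau>0 + of_int i + 1)"
      by (rule Gamma_plus1)
    thus ?thesis unfolding V_def exp_2pi_i_plus1 by (simp only: mult_ac)
  qed
  have "has_improper_contour_integral (hankel_integrand (\<tau>0 + of_int i)) (V (\<tau>0 + of_int i)) C" for i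
  proof (induction i rule: int_induct[where k = 0])
    case base
    have "Re \<tau>0 > -1" "Re \<tau>0 < 1" by (auto simp: \<tau>0_def) linarith+
    thus ?case
      using hankel_integrand_integral[OF C not_pole[of 0, simplified]] by (auto simp: V_def)
  next
    case (step1 i)
    from hankel_integrand_plus1[OF C step1(2)] show ?case by (simp add: V_Suc add.assoc[symmetric])
  next
    \<comment> \<open>Downwards, existence of the integral at degree
      \<open>\<tau>0 + of_int (i - 1)\<close> has to be known first. Its value then follows by
      dividing the functional equation by the nonzero factor
      \<open>\<tau>0 + of_int (i - 1) + 1\<close>.\<close>
    case (step2 i)
    obtain J where J: "has_improper_contour_integral (hankel_integrand (\<tau>0 + of_int (i - 1))) J C"
      using hankel_integrand_integral[OF C not_pole[of "i - 1"]] by blast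
    have eq: "\<tau>0 + of_int (i - 1) + 1 = \<tau>0 + of_int i" by simp
    from hankel_integrand_plus1[OF C J] step2(2)
    have "(\<tau>0 + of_int (i - 1) + 1) * J = V (\<tau>0 + of_int i)"
      unfolding eq by (rule has_improper_contour_integral_unique)
    also have "\<dots> = (\<tau>0 + of_int (i - 1) + 1) * V (\<tau>0 + of_int (i - 1))"
      using V_Suc[of "i - 1"] unfolding eq .
    finally have "J = V (\<tau>0 + of_int (i - 1))" using not_pole[of "i - 1" 0] by simp
    with J show ?case by simp
  qed
  from this[of "\<lfloor>Re \<tau>\<rfloor>"] show ?thesis by (simp add: \<tau>0_def V_def)
qed

lemma gamma_hermite_rhs_eq:
  assumes C: "hankel_contour C" and \<tau>: "\<tau> \<notin> \<int>"
  shows "gamma_hermite_rhs C \<tau> = Gamma (\<tau> + 1)"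
proof -
  \<comment> \<open>Division by this prefactor is genuine, because the exponential equals 1 only at
    integers.\<close>
  have "exp (2 * complex_of_real pi * \<i> * \<tau>) \<noteq> 1"
  proof
    assume "exp (2 * complex_of_real pi * \<i> * \<tau>) = 1"
    then obtain n :: int where n: "Im \<tau> = 0" "2 * pi * Re \<tau> = of_int (2 * n) * pi"
      by (auto simp: exp_eq_1)
    hence "\<tau> = of_int n" by (simp add: complex_eq_iff)
    thus False using \<tau> by simp
  qed
  thus ?thesis
    unfolding gamma_hermite_rhs_def
      improper_contour_integral_unique[OF hankel_integrand_Gamma[OF assms], unfolded hankel_integrand_def]
    by (simp add: field_simps)
qed

lemma eventually_notin_Ints: "\<forall>\<^sub>F \<sigma> in at (\<tau>::complex). \<sigma> \<notin> \<int>" if "\<tau> \<in> \<int>"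
proof -
  from that obtain m where m: "\<tau> = of_int m" by (elim Ints_cases)
  have "\<sigma> \<notin> \<int>" if "\<sigma> \<noteq> \<tau>" "dist \<sigma> \<tau> < 1" for \<sigma>
  proof
    assume "\<sigma> \<in> \<int>"
    then obtain n where n: "\<sigma> = of_int n" by (elim Ints_cases)
    have "dist \<sigma> \<tau> = \<bar>of_int (n - m)\<bar>"
      unfolding n m dist_norm of_int_diff[symmetric] by (rule norm_of_int)
    hence "\<bar>n - m\<bar> < 1" using that(2) by linarith
    thus False using that(1) n m by simp
  qed
  thus ?thesis unfolding eventually_at by (intro exI[of _ 1]) auto
qed

theorem theorem4p3:
  fixes C :: "real \<Rightarrow> complex" and \<tau> :: complex
  assumes "hankel_contour C"
    and "\<forall>n::nat. n \<ge> 1 \<longrightarrow> - \<tau> \<noteq> of_nat n"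
  shows "improper_contour_integrable
           (\<lambda>\<zeta>. cpow_2pi \<zeta> \<tau> * hermite_fun \<tau> \<zeta> * exp (- \<zeta>\<^sup>2)) C \<and>
         (\<tau> \<notin> \<int> \<longrightarrow> Gamma (\<tau> + 1) = gamma_hermite_rhs C \<tau>) \<and>
         (\<tau> \<in> \<int> \<longrightarrow> (gamma_hermite_rhs C \<longlongrightarrow> Gamma (\<tau> + 1)) (at \<tau>))"
proof (intro conjI impI)
  have \<tau>: "\<tau> + 1 + of_nat k \<noteq> 0" for k :: nat
  proof
    assume "\<tau> + 1 + of_nat k = 0"
    hence "- \<tau> = of_nat (Suc k)" by (simp add: add_eq_0_iff add.assoc)
    thus False using assms(2)[rule_format, of "Suc k"] by simp
  qed
  show "improper_contour_integrable (\<lambda>\<zeta>. cpow_2pi \<zeta> \<tau> * hermite_fun \<tau> \<zeta> * exp (- \<zeta>\<^sup>2)) C"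
    using hankel_integrand_integral[OF assms(1) \<tau>]
    unfolding improper_contour_integrable_def hankel_integrand_def by blast
  show "Gamma (\<tau> + 1) = gamma_hermite_rhs C \<tau>" if "\<tau> \<notin> \<int>"
    using gamma_hermite_rhs_eq[OF assms(1) that] by simp
  show "(gamma_hermite_rhs C \<longlongrightarrow> Gamma (\<tau> + 1)) (at \<tau>)" if "\<tau> \<in> \<int>"
  \<comment> \<open>Near the integer \<tau> the nearby \<sigma> are not integers, so the right-hand
    side is Gamma(\<sigma> + 1) there. The hypothesis keeps \<tau> + 1 away from the poles, and
    continuity of Gamma gives the limit.\<close>
  proof (rule Lim_transform_eventually)
    have "\<tau> + 1 \<notin> \<int>\<^sub>\<le>\<^sub>0"
      using \<tau> by (metis add.left_inverse nonpos_Ints_cases')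
    thus "((\<lambda>\<sigma>. Gamma (\<sigma> + 1)) \<longlongrightarrow> Gamma (\<tau> + 1)) (at \<tau>)"
      by (intro tendsto_Gamma tendsto_intros)
    show "\<forall>\<^sub>F \<sigma> in at \<tau>. Gamma (\<sigma> + 1) = gamma_hermite_rhs C \<sigma>"
      using eventually_notin_Ints[OF that]
      by eventually_elim (rule gamma_hermite_rhs_eq[OF assms(1), symmetric])
  qed
qed

end
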